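(* Let $\mathcal X\subset\mathbb R^n$ be a connected, simply connected smooth manifold with generalized boundary. Let $g$ and $h_1,\dots,h_k$ be real-valued $C^\infty$ functions of $(x,y)\in\mathcal X\times\mathbb R^m$ and let $\mathcal Y(x)=\{y\in\mathbb R^m:h_i(x,y)\le0,\ i=1,\dots,k\}$. Assume that $\mathcal Y(x)\neq\emptyset$ for every $x\in\mathcal X$, that the sets $\mathcal Y(x)$, $x\in\mathcal X$, are uniformly bounded, and that LICQ, SCSC and uniform SOSC hold for the lower-level problem $\min_{y\in\mathcal Y(x)}g(x,y)$ at every $x\in\mathcal X$. Then for any $x_0\in\mathcal X$ and any local minimizer $y_0$ of the lower-level problem at $x_0$ there exists a unique global $C^\infty$ local-minimizer branch $y^\ast:\mathcal X\to\mathbb R^m$ with $y^\ast(x_0)=y_0$.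
   Context: A local-minimizer branch is a continuous map $y^\ast$ such that $y^\ast(x)$ is a local minimizer of the lower-level problem at $x$ for each $x$ in its domain; it is global if its domain is $\mathcal X$. A map on $\mathcal X$ is $C^\infty$ if locally it extends to a $C^\infty$ map on an open subset of $\mathbb R^n$. Active set: $\mathcal J(x,y)=\{i:h_i(x,y)=0\}$. KKT pair at $x$: $(y,\lambda)\in\mathbb R^m\times\mathbb R^k$ with $\nabla_y g(x,y)+\sum_i\lambda_i\nabla_y h_i(x,y)=0$, $h_i(x,y)\le 0$, $\lambda_i\ge 0$, $\lambda_i h_i(x,y)=0$ for all $i$. Lagrangian: $\mathcal L(x,y,\lambda)=g(x,y)+\sum_{i}\lambda_i h_i(x,y)$. LICQ holds at $x$ if for every $y\in\mathcal Y(x)$ the vectors $\{\nabla_y h_i(x,y): i\in\mathcal J(x,y)\}$ are linearly independent. SCSC holds at $x$ if for every KKT pair $(y^\ast,\lambda^\ast)$ at $x$ and every $i$, either $h_i(x,y^\ast)<0$ and $\lambda^\ast_i=0$, or $h_i(x,y^\ast)=0$ and $\lambda^\ast_i>0$. Critical cone at a KKT pair $(y^\ast,\lambda^\ast)$: $\mathcal C(x,y^\ast)=\{d\in\mathbb R^m:\nabla_y h_i(x,y^\ast)^\top d=0\text{ if }\lambda^\ast_i>0,\ \nabla_y h_i(x,y^\ast)^\top d\le 0\text{ if }\lambda^\ast_i=0,\ \forall i\in\mathcal J(x,y^\ast)\}$. Uniform SOSC: there is $\sigma>0$, independent of $x$, such that for every $x\in\mathcal X$ and every local minimizer $y^\ast$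 at $x$ with associated KKT multiplier $\lambda^\ast$, $d^\top\nabla^2_{yy}\mathcal L(x,y^\ast,\lambda^\ast)d\ge\sigma\|d\|^2$ for all $d\in\mathcal C(x,y^\ast)$. Manifold with generalized boundary: $X\subset\mathbb R^N$ such that for each $p_0\in X$ there is a local $C^\infty$ coordinate system $\psi:U\to V$ of $\mathbb R^N$ with $\psi(p_0)=0$ and integers $q,p\ge0$ with $\psi(U\cap X)=\{v\in V: v_1=\dots=v_q=0,\ v_{q+1}\ge0,\dots,v_{q+p}\ge0\}$. Uniformly bounded: there is $R>0$ with $\mathcal Y(x)\subset\{y:\|y\|\le R\}$ for all $x\in\mathcal X$. *)

theory Defs
  imports "HOL-Analysis.Analysis"
begin

text \<open>Smoothness on an open set: all iterated directional derivatives exist and are continuous.\<close>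

primrec Ck_on :: "nat \<Rightarrow> ('a::euclidean_space \<Rightarrow> 'b::euclidean_space) \<Rightarrow> 'a set \<Rightarrow> bool" where
  "Ck_on 0 f S \<longleftrightarrow> continuous_on S f"
| "Ck_on (Suc r) f S \<longleftrightarrow> (\<forall>x\<in>S. f differentiable (at x)) \<and>
     (\<forall>v. Ck_on r (\<lambda>x. frechet_derivative f (at x) v) S)"

definition smooth_on_open :: "('a::euclidean_space \<Rightarrow> 'b::euclidean_space) \<Rightarrow> 'a set \<Rightarrow> bool" where
  "smooth_on_open f S \<longleftrightarrow> open S \<and> (\<forall>r. Ck_on r f S)"

definition smooth_map_on :: "('a::euclidean_space \<Rightarrow> 'b::euclidean_space) \<Rightarrow> 'a set \<Rightarrow> bool" where
  "smooth_map_on f X \<longleftrightarrow>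
     (\<forall>p\<in>X. \<exists>U F. p \<in> U \<and> smooth_on_open F U \<and> (\<forall>x\<in>U \<inter> X. F x = f x))"

text \<open>
  The index type is unordered, so the first \<open>q\<close> and the next \<open>p\<close> coordinates are replaced by
  disjoint sets \<open>Q\<close> and \<open>P\<close> of indices, of sizes \<open>q\<close> and \<open>p\<close>. Renumbering coordinates is a linear
  diffeomorphism, so this is no restriction on the chart.
\<close>

definition manifold_gen_boundary :: "(real^'n) set \<Rightarrow> bool" where
  "manifold_gen_boundary X \<longleftrightarrow>
     (\<forall>p0\<in>X. \<exists>U. \<exists>V :: (real^'n) set. \<exists>\<psi> \<phi>. \<exists>Q P :: 'n set.
        p0 \<in> U \<and> homeomorphism U V \<psi> \<phi> \<and> smooth_on_open \<psi> U \<and> smooth_on_open \<phi> V \<and>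
        \<psi> p0 = 0 \<and> Q \<inter> P = {} \<and>
        \<psi> ` (U \<inter> X) = {v\<in>V. (\<forall>i\<in>Q. v $ i = 0) \<and> (\<forall>i\<in>P. v $ i \<ge> 0)})"

definition grad :: "(real^'m \<Rightarrow> real) \<Rightarrow> real^'m \<Rightarrow> real^'m" where
  "grad f y = (THE D. GDERIV f y :> D)"

definition hessian :: "(real^'m \<Rightarrow> real) \<Rightarrow> real^'m \<Rightarrow> real^'m^'m" where
  "hessian f y = jacobian (grad f) (at y)"

definition feasible :: "('k \<Rightarrow> real^'n \<Rightarrow> real^'m \<Rightarrow> real) \<Rightarrow> real^'n \<Rightarrow> (real^'m) set" where
  "feasible h x = {y. \<forall>i. h i x y \<le> 0}"

definition active :: "('k \<Rightarrow> real^'n \<Rightarrow> real^'m \<Rightarrow> real) \<Rightarrow> real^'n \<Rightarrow> real^'m \<Rightarrow> 'k set" where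
  "active h x y = {i. h i x y = 0}"

definition lagrangian ::
  "(real^'n \<Rightarrow> real^'m \<Rightarrow> real) \<Rightarrow> ('k::finite \<Rightarrow> real^'n \<Rightarrow> real^'m \<Rightarrow> real) \<Rightarrow>
   real^'n \<Rightarrow> real^'m \<Rightarrow> real^'k \<Rightarrow> real" where
  "lagrangian g h x y l = g x y + (\<Sum>i\<in>UNIV. l $ i * h i x y)"

definition local_minimizer ::
  "(real^'n \<Rightarrow> real^'m \<Rightarrow> real) \<Rightarrow> ('k \<Rightarrow> real^'n \<Rightarrow> real^'m \<Rightarrow> real) \<Rightarrow>
   real^'n \<Rightarrow> real^'m \<Rightarrow> bool" where
  "local_minimizer g h x y \<longleftrightarrow> y \<in> feasible h x \<and>
     (\<exists>e>0. \<forall>z\<in>feasible h x. dist z y < e \<longrightarrow> g x y \<le> g x z)"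

definition KKT_pair ::
  "(real^'n \<Rightarrow> real^'m \<Rightarrow> real) \<Rightarrow> ('k::finite \<Rightarrow> real^'n \<Rightarrow> real^'m \<Rightarrow> real) \<Rightarrow>
   real^'n \<Rightarrow> real^'m \<Rightarrow> real^'k \<Rightarrow> bool" where
  "KKT_pair g h x y l \<longleftrightarrow>
     grad (g x) y + (\<Sum>i\<in>UNIV. l $ i *\<^sub>R grad (h i x) y) = 0 \<and>
     (\<forall>i. h i x y \<le> 0 \<and> l $ i \<ge> 0 \<and> l $ i * h i x y = 0)"

text \<open>
  Linear independence is meant for the indexed family of active gradients; hence the injectivity
  clause, since the image set alone would not see repeated gradients.
\<close>

definition LICQ :: "('k \<Rightarrow> real^'n \<Rightarrow> real^'m \<Rightarrow> real) \<Rightarrow> real^'n \<Rightarrow> bool" where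
  "LICQ h x \<longleftrightarrow> (\<forall>y\<in>feasible h x.
     inj_on (\<lambda>i. grad (h i x) y) (active h x y) \<and>
     independent ((\<lambda>i. grad (h i x) y) ` active h x y))"

definition SCSC ::
  "(real^'n \<Rightarrow> real^'m \<Rightarrow> real) \<Rightarrow> ('k::finite \<Rightarrow> real^'n \<Rightarrow> real^'m \<Rightarrow> real) \<Rightarrow>
   real^'n \<Rightarrow> bool" where
  "SCSC g h x \<longleftrightarrow> (\<forall>y l. KKT_pair g h x y l \<longrightarrow>
     (\<forall>i. (h i x y < 0 \<and> l $ i = 0) \<or> (h i x y = 0 \<and> l $ i > 0)))"

definition critical_cone ::
  "('k::finite \<Rightarrow> real^'n \<Rightarrow> real^'m \<Rightarrow> real) \<Rightarrow> real^'n \<Rightarrow> real^'m \<Rightarrow> real^'k \<Rightarrow>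
   (real^'m) set" where
  "critical_cone h x y l = {d. \<forall>i\<in>active h x y.
     (l $ i > 0 \<longrightarrow> grad (h i x) y \<bullet> d = 0) \<and> (l $ i = 0 \<longrightarrow> grad (h i x) y \<bullet> d \<le> 0)}"

definition uniform_SOSC ::
  "(real^'n \<Rightarrow> real^'m \<Rightarrow> real) \<Rightarrow> ('k::finite \<Rightarrow> real^'n \<Rightarrow> real^'m \<Rightarrow> real) \<Rightarrow>
   (real^'n) set \<Rightarrow> bool" where
  "uniform_SOSC g h X \<longleftrightarrow> (\<exists>\<sigma>>0. \<forall>x\<in>X. \<forall>y l.
     local_minimizer g h x y \<longrightarrow> KKT_pair g h x y l \<longrightarrow>
     (\<forall>d\<in>critical_cone h x y l.
        d \<bullet> (hessian (\<lambda>z. lagrangian g h x z l) y *v d) \<ge> \<sigma> * (norm d)\<^sup>2))"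

definition uniformly_bounded ::
  "('k \<Rightarrow> real^'n \<Rightarrow> real^'m \<Rightarrow> real) \<Rightarrow> (real^'n) set \<Rightarrow> bool" where
  "uniformly_bounded h X \<longleftrightarrow> (\<exists>R>0. \<forall>x\<in>X. feasible h x \<subseteq> {y. norm y \<le> R})"

definition local_minimizer_branch ::
  "(real^'n \<Rightarrow> real^'m \<Rightarrow> real) \<Rightarrow> ('k \<Rightarrow> real^'n \<Rightarrow> real^'m \<Rightarrow> real) \<Rightarrow>
   (real^'n) set \<Rightarrow> (real^'n \<Rightarrow> real^'m) \<Rightarrow> bool" where
  "local_minimizer_branch g h D ys \<longleftrightarrow>
     continuous_on D ys \<and> (\<forall>x\<in>D. local_minimizer g h x (ys x))"

end

(* Let E be the set of pairs (x, y) with y a local minimizer at x. The projection E -> X is a covering map,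
   so simple connectedness of X lets the identity of X be lifted to E through (x0, y0).

   Near a local minimizer, E is the graph of a smooth function: under LICQ, SCSC and SOSC the equations
   grad L = 0, l_i h_i = 0 in (y, l) are nonsingular. The implicit solution s(x) is again a local minimizer,
   because minimizers of g(x, -) over feasible points in a small ball converge to y as x tends to the base
   point, and are therefore KKT points on the solution branch.

   E is closed in X x R^m: LICQ bounds the multipliers, so limits of KKT pairs are KKT pairs; the active set
   is locally constant by SCSC, and the uniform constant in SOSC survives the limit. Closedness, boundedness of
   the fibres and the local graph structure give even coverings with finitely many sheets. *)
theory Submission
  imports Defs
begin

section \<open>Calculus of smooth maps\<close>

text \<open>At a limit, the inequality is first carried over with the fixed constant \<sigma> and
  only then converted into minimality; a constant depending on x could degenerate to 0 there, and a
  sheet could break off. At a nearby point, minimality is obtained by compactness, without a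
  second-order inequality at that point. \<open>X\<close> need not have interior points, so g and h
  have no derivatives in x of their own. Derivatives in y are intrinsic and agree with those of any
  local smooth extension. The implicit function theorem is applied to such an extension and its
  solution is interpreted only over \<open>X\<close>; therefore the limit arguments run along
  sequences in \<open>X\<close>. Smoothness is defined through derivatives in fixed directions.
  Where a derivative is evaluated in a direction that itself varies, the direction is expanded in a
  basis, which leaves finite sums of products.\<close>

lemma Ck_on_subset: "Ck_on r f S \<Longrightarrow> T \<subseteq> S \<Longrightarrow> Ck_on r f T"
  by (induction r arbitrary: f) (auto intro: continuous_on_subset)

lemma Ck_on_cong:
  assumes "open S" "\<And>x. x \<in> S \<Longrightarrow> f x = g x" "Ck_on r f S"
  shows "Ck_on r g S"
  using assms(2,3)
proof (induction r arbitrary: f g)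
  case 0
  then show ?case using continuous_on_cong by force
next
  case (Suc r)
  have der: "(g has_derivative frechet_derivative f (at x)) (at x)" if "x \<in> S" for x
  proof (rule has_derivative_transform_within_open)
    show "(f has_derivative frechet_derivative f (at x)) (at x)"
      using Suc.prems(2) that frechet_derivative_works by auto
  qed (use that assms(1) Suc.prems(1) in auto)
  have "Ck_on r (\<lambda>x. frechet_derivative g (at x) v) S" for v
    using Suc.IH[of "\<lambda>x. frechet_derivative f (at x) v"] Suc.prems(2) frechet_derivative_at[OF der]
    by simp
  then show ?case
    using der unfolding Ck_on.simps differentiable_def by blast
qed

text \<open>Converts the recursion for \<open>Ck_on\<close> to an explicit derivative
  \<open>f'\<close> in place of \<open>frechet_derivative\<close>; each closure rule below then
  amounts to a derivative formula and an induction on the order.\<close>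

lemma Ck_on_SucI:
  assumes "open S" "\<And>x. x \<in> S \<Longrightarrow> (f has_derivative f' x) (at x)"
    "\<And>v. Ck_on r (\<lambda>x. f' x v) S"
  shows "Ck_on (Suc r) f S"
proof -
  have "Ck_on r (\<lambda>x. frechet_derivative f (at x) v) S" for v
    by (rule Ck_on_cong[OF assms(1) _ assms(3)[of v]]) (simp add: frechet_derivative_at[OF assms(2), symmetric])
  then show ?thesis
    using assms(2) unfolding Ck_on.simps differentiable_def by blast
qed

lemma Ck_on_Suc_has_derivative:
  "Ck_on (Suc r) f S \<Longrightarrow> x \<in> S \<Longrightarrow> (f has_derivative frechet_derivative f (at x)) (at x)"
  using frechet_derivative_works by auto

lemma Ck_on_SucD: "Ck_on (Suc r) f S \<Longrightarrow> Ck_on r f S"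
proof (induction r arbitrary: f)
  case 0
  then show ?case
    by (auto intro!: differentiable_imp_continuous_on simp: differentiable_on_def differentiable_at_withinI)
next
  case (Suc r)
  then show ?case by (metis Ck_on.simps(2))
qed

lemma Ck_on_imp_continuous_on: "Ck_on r f S \<Longrightarrow> continuous_on S f"
  by (induction r) (auto dest: Ck_on_SucD simp del: Ck_on.simps(2))

lemma Ck_on_const: "open S \<Longrightarrow> Ck_on r (\<lambda>x. c) S"
proof (induction r arbitrary: c)
  case (Suc r)
  show ?case by (rule Ck_on_SucI[OF Suc.prems has_derivative_const Suc.IH[OF Suc.prems]])
qed auto

lemma Ck_on_bounded_linear:
  assumes "open S" "bounded_linear L"
  shows "Ck_on r L S"
proof (cases r)
  case 0
  then show ?thesis using assms(2) linear_continuous_on by auto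
next
  case (Suc k)
  show ?thesis unfolding Suc
    by (rule Ck_on_SucI[OF assms(1) bounded_linear_imp_has_derivative[OF assms(2)] Ck_on_const[OF assms(1)]])
qed

lemma Ck_on_linear_compose:
  assumes "open S" "bounded_linear L" "Ck_on r f S"
  shows "Ck_on r (\<lambda>x. L (f x)) S"
  using assms(3)
proof (induction r arbitrary: f)
  case 0
  then show ?case
    using bounded_linear.continuous_on[OF assms(2)] by auto
next
  case (Suc r)
  show ?case
  proof (rule Ck_on_SucI[OF assms(1)])
    show "((\<lambda>x. L (f x)) has_derivative (\<lambda>v. L (frechet_derivative f (at x) v))) (at x)" if "x \<in> S" for x
      by (rule bounded_linear.has_derivative[OF assms(2) Ck_on_Suc_has_derivative[OF Suc.prems that]])
  qed (use Suc in auto)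
qed

lemma Ck_on_add:
  assumes "open S" "Ck_on r f S" "Ck_on r g S"
  shows "Ck_on r (\<lambda>x. f x + g x) S"
  using assms(2,3)
proof (induction r arbitrary: f g)
  case 0
  then show ?case by (auto intro: continuous_on_add)
next
  case (Suc r)
  show ?case
  proof (rule Ck_on_SucI[OF assms(1)])
    show "((\<lambda>x. f x + g x) has_derivative
        (\<lambda>v. frechet_derivative f (at x) v + frechet_derivative g (at x) v)) (at x)" if "x \<in> S" for x
      using that by (intro has_derivative_add Suc.prems[THEN Ck_on_Suc_has_derivative])
  qed (use Suc in auto)
qed

lemma Ck_on_sum:
  assumes "open S" "finite I" "\<And>i. i \<in> I \<Longrightarrow> Ck_on r (f i) S"
  shows "Ck_on r (\<lambda>x. \<Sum>i\<in>I. f i x) S"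
  using assms(2,3)
  by (induction rule: finite_induct) (auto intro: Ck_on_const Ck_on_add assms(1))

lemma Ck_on_bilinear:
  fixes prod :: "'b::euclidean_space \<Rightarrow> 'c::euclidean_space \<Rightarrow> 'd::euclidean_space"
  assumes "open S" "bounded_bilinear prod" "Ck_on r f S" "Ck_on r g S"
  shows "Ck_on r (\<lambda>x. prod (f x) (g x)) S"
  using assms(3,4)
proof (induction r arbitrary: f g)
  case 0
  then show ?case using bounded_bilinear.continuous_on[OF assms(2)] by auto
next
  case (Suc r)
  show ?case
  proof (rule Ck_on_SucI[OF assms(1)])
    show "((\<lambda>x. prod (f x) (g x)) has_derivative
        (\<lambda>v. prod (f x) (frechet_derivative g (at x) v) + prod (frechet_derivative f (at x) v) (g x))) (at x)"
      if "x \<in> S" for x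
      using that by (intro bounded_bilinear.FDERIV[OF assms(2)] Suc.prems[THEN Ck_on_Suc_has_derivative])
    show "Ck_on r (\<lambda>x. prod (f x) (frechet_derivative g (at x) v) +
        prod (frechet_derivative f (at x) v) (g x)) S" for v
      using Suc.prems Ck_on_SucD[OF Suc.prems(1)] Ck_on_SucD[OF Suc.prems(2)]
      by (intro Ck_on_add[OF assms(1)] Suc.IH) auto
  qed
qed

lemma linear_eq_sum_Basis:
  fixes L :: "'a::euclidean_space \<Rightarrow> 'b::real_vector"
  assumes "linear L"
  shows "L v = (\<Sum>b\<in>Basis. (v \<bullet> b) *\<^sub>R L b)"
proof -
  have "L (\<Sum>b\<in>Basis. (v \<bullet> b) *\<^sub>R b) = (\<Sum>b\<in>Basis. (v \<bullet> b) *\<^sub>R L b)"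
    by (simp add: linear_sum[OF assms] linear_cmul[OF assms])
  then show ?thesis by (simp add: euclidean_representation)
qed

lemma Ck_on_compose:
  assumes "open S" "open T" "Ck_on r f T" "Ck_on r g S" "g ` S \<subseteq> T"
  shows "Ck_on r (\<lambda>x. f (g x)) S"
  using assms(3,4)
proof (induction r arbitrary: f)
  case 0
  then show ?case using assms(5) continuous_on_compose2 by auto
next
  case (Suc r)
  let ?f = "\<lambda>x. frechet_derivative f (at x)" and ?g = "\<lambda>x. frechet_derivative g (at x)"
  show ?case
  proof (rule Ck_on_SucI[OF assms(1)])
    show "((\<lambda>x. f (g x)) has_derivative (\<lambda>v. \<Sum>b\<in>Basis. (?g x v \<bullet> b) *\<^sub>R ?f (g x) b)) (at x)"
      if "x \<in> S" for x
    proof -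
      have f: "(f has_derivative ?f (g x)) (at (g x))"
        using that assms(5) Ck_on_Suc_has_derivative[OF Suc.prems(1)] by blast
      have "((\<lambda>x. f (g x)) has_derivative (\<lambda>v. ?f (g x) (?g x v))) (at x)"
        using has_derivative_compose[OF Ck_on_Suc_has_derivative[OF Suc.prems(2) that] f] .
      \<comment> \<open>The direction \<open>?g x v\<close> moves with \<open>x\<close>, whereas the
        hypothesis on \<open>f\<close> controls its derivative in fixed directions only; the basis
        expansion separates the two dependences.\<close>
      moreover have "?f (g x) (?g x v) = (\<Sum>b\<in>Basis. (?g x v \<bullet> b) *\<^sub>R ?f (g x) b)" for v
        by (rule linear_eq_sum_Basis[OF has_derivative_linear[OF f]])
      ultimately show ?thesis by simp
    qed
    show "Ck_on r (\<lambda>x. \<Sum>b\<in>Basis. (?g x v \<bullet> b) *\<^sub>R ?f (g x) b) S" for v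
    proof (intro Ck_on_sum[OF assms(1)] Ck_on_bilinear[OF assms(1) bounded_bilinear_scaleR])
      fix b :: 'b
      show "Ck_on r (\<lambda>x. ?g x v \<bullet> b) S"
        using Suc.prems(2) by (intro Ck_on_linear_compose[OF assms(1) bounded_linear_inner_left]) auto
      show "Ck_on r (\<lambda>x. ?f (g x) b) S"
        using Suc.prems Ck_on_SucD[OF Suc.prems(2)] by (intro Suc.IH[of "\<lambda>y. ?f y b"]) auto
    qed auto
  qed
qed

lemma Ck_on_Pair:
  assumes "open S" "Ck_on r f S" "Ck_on r g S"
  shows "Ck_on r (\<lambda>x. (f x, g x)) S"
proof -
  have "Ck_on r (\<lambda>x. (f x, 0) + (0, g x)) S"
    using assms
    by (intro Ck_on_add Ck_on_linear_compose[of S "\<lambda>u. (u, 0)"] Ck_on_linear_compose[of S "\<lambda>u. (0, u)"])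
      (auto intro!: bounded_linear_Pair bounded_linear_zero bounded_linear_ident)
  then show ?thesis by simp
qed

lemma Ck_on_fst: "open S \<Longrightarrow> Ck_on r f S \<Longrightarrow> Ck_on r (\<lambda>x. fst (f x)) S"
  by (rule Ck_on_linear_compose[OF _ bounded_linear_fst])

lemma Ck_on_snd: "open S \<Longrightarrow> Ck_on r f S \<Longrightarrow> Ck_on r (\<lambda>x. snd (f x)) S"
  by (rule Ck_on_linear_compose[OF _ bounded_linear_snd])


section \<open>Inverses of families of linear maps\<close>

text \<open>The usual product rule would need \<open>g\<close> differentiable. Where the scalar
  factor vanishes, continuity of \<open>g\<close> is enough, because the error
  \<open>f y *\<^sub>R (g y - g x)\<close> is o(|y - x|). This makes it possible to differentiate a
  family of inverses through a formula that contains those inverses, while they are only known to be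
  continuous.\<close>

lemma has_derivative_scaleR_vanishing:
  fixes f :: "'a::real_normed_vector \<Rightarrow> real" and g :: "'a \<Rightarrow> 'b::real_normed_vector"
  assumes f: "(f has_derivative f') (at x)" and "f x = 0" and g: "isCont g x"
  shows "((\<lambda>y. f y *\<^sub>R g y) has_derivative (\<lambda>v. f' v *\<^sub>R g x)) (at x)"
proof -
  have lin: "bounded_linear f'" using f has_derivative_bounded_linear by blast
  obtain K where K: "\<And>v. norm (f' v) \<le> norm v * K" "K > 0"
    using bounded_linear.pos_bounded[OF lin] by blast
  have "((\<lambda>y. f y *\<^sub>R (g y - g x)) has_derivative (\<lambda>v. 0)) (at x)"
    unfolding has_derivative_within_alt
  proof (intro conjI allI impI bounded_linear_zero)
    fix e :: real assume "e > 0"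
    obtain d1 where d1: "d1 > 0" "\<And>y. norm (y - x) < d1 \<Longrightarrow> norm (f y - f x - f' (y - x)) \<le> norm (y - x)"
      using f[unfolded has_derivative_within_alt] by (metis UNIV_I mult_1 zero_less_one)
    \<comment> \<open>Near \<open>x\<close> one has |f y| <= (K + 1) |y - x|: \<open>K\<close>
      bounds the derivative and 1 the remainder controlled by \<open>d1\<close>.\<close>
    have "e / (K + 1) > 0" using \<open>e > 0\<close> \<open>K > 0\<close> by simp
    then obtain d2 where d2: "d2 > 0" "\<And>y. norm (y - x) < d2 \<Longrightarrow> norm (g y - g x) < e / (K + 1)"
      using g[unfolded continuous_at_eps_delta] by (metis dist_norm)
    show "\<exists>d>0. \<forall>y\<in>UNIV. norm (y - x) < d \<longrightarrow>
      norm (f y *\<^sub>R (g y - g x) - f x *\<^sub>R (g x - g x) - 0) \<le> e * norm (y - x)"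
    proof (intro exI[of _ "min d1 d2"] conjI ballI impI)
      fix y assume "norm (y - x) < min d1 d2"
      then have *: "norm (f y - f' (y - x)) \<le> norm (y - x)" "norm (g y - g x) < e / (K + 1)"
        using d1(2)[of y] d2(2)[of y] \<open>f x = 0\<close> by auto
      have "norm (f y) \<le> (K + 1) * norm (y - x)"
        using *(1) K(1)[of "y - x"] by (simp add: algebra_simps abs_le_iff)
      then have "norm (f y *\<^sub>R (g y - g x)) \<le> ((K + 1) * norm (y - x)) * (e / (K + 1))"
        unfolding norm_scaleR real_norm_def[symmetric] using *(2) K(2) by (intro mult_mono) auto
      then show "norm (f y *\<^sub>R (g y - g x) - f x *\<^sub>R (g x - g x) - 0) \<le> e * norm (y - x)"
        using K(2) by (simp add: mult.commute)
    qed (use d1 d2 in auto)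
  qed
  from has_derivative_add[OF has_derivative_scaleR_left[OF f, of "g x"] this] show ?thesis
    by (simp add: algebra_simps)
qed

text \<open>If \<open>C\<close> bounds \<open>B a\<close> and \<open>A x\<close> differs from
  \<open>A a\<close> by at most 1/(2C) in operator norm, then 2C bounds \<open>B x\<close>.
  Continuity then follows from \<open>B x v - B a v = B x (A a (B a v) - A x (B a v))\<close>.
  Pointwise continuity of \<open>A\<close> suffices because the operator norm is dominated by a
  finite sum over \<open>Basis\<close>.\<close>

lemma continuous_on_inverse_family:
  fixes A B :: "'a::topological_space \<Rightarrow> 'b::euclidean_space \<Rightarrow> 'b"
  assumes "\<And>x. x \<in> S \<Longrightarrow> linear (A x)"
    and "\<And>x. x \<in> S \<Longrightarrow> linear (B x)"
    and BA: "\<And>x v. x \<in> S \<Longrightarrow> B x (A x v) = v"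
    and AB: "\<And>x v. x \<in> S \<Longrightarrow> A x (B x v) = v"
    and cont: "\<And>v. continuous_on S (\<lambda>x. A x v)"
  shows "continuous_on S (\<lambda>x. B x v)"
  unfolding continuous_on_def
proof
  fix a assume a: "a \<in> S"
  let ?F = "at a within S"
  have S: "eventually (\<lambda>x. x \<in> S) ?F"
    by (simp add: eventually_at_filter)
  obtain C where C: "C > 0" "\<And>v. norm (B a v) \<le> C * norm v"
    using linear_bounded_pos[OF assms(2)[OF a]] by blast
  have A_tendsto: "((\<lambda>x. A x v) \<longlongrightarrow> A a v) ?F" for v
    using cont a by (simp add: continuous_on_def)
  have "((\<lambda>x. \<Sum>b\<in>Basis. norm (A x b - A a b)) \<longlongrightarrow> (\<Sum>b\<in>(Basis::'b set). norm (A a b - A a b))) ?F"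
    by (intro tendsto_intros A_tendsto)
  then have "eventually (\<lambda>x. (\<Sum>b\<in>Basis. norm (A x b - A a b)) < 1 / (2 * C)) ?F"
    using C(1) by (intro order_tendstoD(2)[where y=0]) auto
  then have bound: "eventually (\<lambda>x. \<forall>v. norm (B x v) \<le> 2 * C * norm v) ?F"
    using S
  proof eventually_elim
    case (elim x)
    show ?case
    proof
      fix v
      define w where "w = B x v"
      have "linear (\<lambda>u. A x u - A a u)"
        using assms(1) elim(2) a by (intro linear_compose_sub) auto
      then have "norm (A x w - A a w) \<le> (\<Sum>b\<in>Basis. norm ((w \<bullet> b) *\<^sub>R (A x b - A a b)))"
        using linear_eq_sum_Basis[of "\<lambda>u. A x u - A a u" w] norm_sum by metis
      also have "\<dots> \<le> (\<Sum>b\<in>Basis. norm w * norm (A x b - A a b))"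
        by (intro sum_mono) (auto intro!: mult_right_mono Basis_le_norm)
      also have "\<dots> \<le> norm w * (1 / (2 * C))"
        unfolding sum_distrib_left[symmetric] using elim(1) by (intro mult_left_mono) auto
      finally have *: "norm (A x w - A a w) \<le> norm w / (2 * C)" by simp
      have "norm w = norm (B a (A a w))" by (simp add: BA a)
      also have "\<dots> \<le> C * norm (A x w - (A x w - A a w))" using C(2) by simp
      also have "\<dots> \<le> C * (norm (A x w) + norm w / (2 * C))"
        using * C(1) by (intro mult_left_mono order_trans[OF norm_triangle_ineq4]) auto
      finally show "norm (B x v) \<le> 2 * C * norm v"
        using C(1) AB[OF elim(2), of v] by (simp add: w_def field_simps)
    qed
  qed
  have "((\<lambda>x. B x v - B a v) \<longlongrightarrow> 0) ?F"
  proof (rule Lim_null_comparison)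
    show "eventually (\<lambda>x. norm (B x v - B a v) \<le> 2 * C * norm (A a (B a v) - A x (B a v))) ?F"
      using bound S
    proof eventually_elim
      case (elim x)
      have "B x v - B a v = B x (A a (B a v) - A x (B a v))"
        using elim(2) a by (simp add: linear_diff[OF assms(2)] AB BA)
      then show ?case using elim(1) by simp
    qed
    have "((\<lambda>x. 2 * C * norm (A a (B a v) - A x (B a v))) \<longlongrightarrow> 2 * C * norm (A a (B a v) - A a (B a v))) ?F"
      by (intro tendsto_intros A_tendsto)
    then show "((\<lambda>x. 2 * C * norm (A a (B a v) - A x (B a v))) \<longlongrightarrow> 0) ?F" by simp
  qed
  then show "((\<lambda>x. B x v) \<longlongrightarrow> B a v) ?F"
    using LIM_zero_iff by blast
qed

text \<open>The derivative of \<open>x \<mapsto> A(x)\<^sup>-\<^sup>1 v\<close> in direction \<open>u\<close> is \<open>- A(x)\<^sup>-\<^sup>1 (D\<^sub>uA(x)) A(x)\<^sup>-\<^sup>1 v\<close>;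
  expanding both inner arguments in a basis leaves products of functions already known to be \<open>C\<^sup>r\<close>.\<close>

lemma Ck_on_inverse_family:
  fixes A B :: "'a::euclidean_space \<Rightarrow> 'b::euclidean_space \<Rightarrow> 'b"
  assumes "open S"
    and linA: "\<And>x. x \<in> S \<Longrightarrow> linear (A x)"
    and linB: "\<And>x. x \<in> S \<Longrightarrow> linear (B x)"
    and BA: "\<And>x v. x \<in> S \<Longrightarrow> B x (A x v) = v"
    and AB: "\<And>x v. x \<in> S \<Longrightarrow> A x (B x v) = v"
    and "\<And>v. Ck_on r (\<lambda>x. A x v) S"
  shows "Ck_on r (\<lambda>x. B x v) S"
  using assms(6)
proof (induction r arbitrary: v)
  case 0
  have "continuous_on S (\<lambda>x. B x v)"
    by (rule continuous_on_inverse_family[OF linA linB BA AB]) (use 0 in auto)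
  then show ?case by simp
next
  case (Suc r)
  let ?A' = "\<lambda>w x u. frechet_derivative (\<lambda>x. A x w) (at x) u"
  let ?D = "\<lambda>x u. \<Sum>b\<in>Basis. (\<Sum>c\<in>Basis. - ((B x v \<bullet> c) * (?A' c x u \<bullet> b))) *\<^sub>R B x b"
  have IH: "Ck_on r (\<lambda>x. B x v) S" for v
    using Suc.IH Suc.prems Ck_on_SucD by blast
  show ?case
  proof (rule Ck_on_SucI[OF assms(1)])
    fix a assume a: "a \<in> S"
    define w where "w = B a v"
    have contB: "isCont (\<lambda>x. B x b) a" for b
      using Ck_on_imp_continuous_on[OF IH] assms(1) a continuous_on_eq_continuous_at by blast
    have dA: "((\<lambda>x. A x c) has_derivative ?A' c a) (at a)" for c
      using Ck_on_Suc_has_derivative[OF Suc.prems a] by simp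
    have "((\<lambda>x. \<Sum>c\<in>Basis. - ((w \<bullet> c) * (A x c \<bullet> b))) has_derivative
        (\<lambda>u. \<Sum>c\<in>Basis. - ((w \<bullet> c) * (?A' c a u \<bullet> b)))) (at a)" for b
      by (intro has_derivative_sum has_derivative_minus has_derivative_mult_right
          has_derivative_inner_left dA)
    then have f: "((\<lambda>x. (\<Sum>c\<in>Basis. - ((w \<bullet> c) * (A x c \<bullet> b))) + v \<bullet> b) has_derivative
        (\<lambda>u. \<Sum>c\<in>Basis. - ((w \<bullet> c) * (?A' c a u \<bullet> b)))) (at a)" for b
      using has_derivative_add[OF _ has_derivative_const] by fastforce
    have Aw: "(\<Sum>c\<in>Basis. - ((w \<bullet> c) * (A x c \<bullet> b))) = - (A x w \<bullet> b)" if "x \<in> S" for x b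
    proof -
      have "A x w = (\<Sum>c\<in>Basis. (w \<bullet> c) *\<^sub>R A x c)"
        by (rule linear_eq_sum_Basis[OF linA[OF that]])
      then show ?thesis by (simp add: inner_sum_left sum_negf)
    qed
    \<comment> \<open>The sum equals \<open>B x (v - A x w)\<close>, that is,
      \<open>B x v - w\<close>. Its scalar coefficients vanish at \<open>a\<close> because
      \<open>A a w = v\<close>, so continuity of each \<open>B x b\<close> is all that
      differentiation needs.\<close>
    have "((\<lambda>x. \<Sum>b\<in>Basis. ((\<Sum>c\<in>Basis. - ((w \<bullet> c) * (A x c \<bullet> b))) + v \<bullet> b) *\<^sub>R B x b) has_derivative
        (\<lambda>u. ?D a u)) (at a)"
      unfolding w_def[symmetric]
      by (intro has_derivative_sum has_derivative_scaleR_vanishing f contB) (simp add: Aw[OF a] AB[OF a, of v, folded w_def])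
    from has_derivative_add[OF this has_derivative_const[of w]]
    have der: "((\<lambda>x. (\<Sum>b\<in>Basis. ((\<Sum>c\<in>Basis. - ((w \<bullet> c) * (A x c \<bullet> b))) + v \<bullet> b) *\<^sub>R B x b) + w)
        has_derivative ?D a) (at a)" by simp
    show "((\<lambda>x. B x v) has_derivative ?D a) (at a)"
    proof (rule has_derivative_transform_within_open[OF der assms(1) a])
      fix x assume x: "x \<in> S"
      have "(\<Sum>b\<in>Basis. ((\<Sum>c\<in>Basis. - ((w \<bullet> c) * (A x c \<bullet> b))) + v \<bullet> b) *\<^sub>R B x b)
          = (\<Sum>b\<in>Basis. ((v - A x w) \<bullet> b) *\<^sub>R B x b)"
        by (simp add: Aw[OF x] inner_diff_left)
      also have "\<dots> = B x (v - A x w)"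
        by (rule linear_eq_sum_Basis[OF linB[OF x], symmetric])
      also have "\<dots> = B x v - w"
        by (simp add: linear_diff[OF linB[OF x]] BA x)
      finally show "(\<Sum>b\<in>Basis. ((\<Sum>c\<in>Basis. - ((w \<bullet> c) * (A x c \<bullet> b))) + v \<bullet> b) *\<^sub>R B x b) + w = B x v"
        by simp
    qed
  next
    fix u
    have A': "Ck_on r (\<lambda>x. ?A' c x u) S" for c
      using Suc.prems[of c] by simp
    show "Ck_on r (\<lambda>x. ?D x u) S"
      unfolding sum_negf[symmetric] mult_minus_left[symmetric] inner_minus_left[symmetric]
      by (intro Ck_on_sum assms(1) finite_Basis
          Ck_on_bilinear[OF _ bounded_bilinear_scaleR] Ck_on_bilinear[OF _ bounded_bilinear_mult]
          Ck_on_linear_compose[OF assms(1) bounded_linear_inner_left]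
          Ck_on_linear_compose[OF assms(1) bounded_linear_minus[OF bounded_linear_ident]] A' IH)
  qed
qed

section \<open>Inverse and implicit function theorems for smooth maps\<close>

text \<open>The C^1 theorem supplies \<open>g\<close> with \<open>g' y = inv (f' (g y))\<close>, and
  smoothness is bootstrapped from this formula: if \<open>g\<close> is C^r, then so is
  \<open>\<lambda>y. f' (g y) v\<close> by composition, hence also the family of inverses, so
  \<open>g\<close> is C^(r+1).\<close>

lemma smooth_inverse_function:
  fixes f :: "'a::euclidean_space \<Rightarrow> 'a"
  assumes "smooth_on_open f U" "a \<in> U"
    and inj: "\<And>v. frechet_derivative f (at a) v = 0 \<Longrightarrow> v = 0"
  obtains U' V g where "open U'" "U' \<subseteq> U" "a \<in> U'" "f a \<in> V" "homeomorphism U' V f g"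
    "smooth_on_open g V"
proof -
  have "open U" and Ck: "\<And>r. Ck_on r f U" using assms(1) by (auto simp: smooth_on_open_def)
  have der: "(f has_derivative frechet_derivative f (at x)) (at x)" if "x \<in> U" for x
    using Ck_on_Suc_has_derivative[OF Ck that] .
  define f' where "f' x = Blinfun (frechet_derivative f (at x))" for x
  have f': "blinfun_apply (f' x) = frechet_derivative f (at x)" if "x \<in> U" for x
    unfolding f'_def using der[OF that] by (simp add: bounded_linear_Blinfun_apply has_derivative_bounded_linear)
  have Ck': "Ck_on r (\<lambda>x. f' x v) U" for r v
    by (rule Ck_on_cong[OF \<open>open U\<close>, of "\<lambda>x. frechet_derivative f (at x) v"])
      (use Ck[of "Suc r"] in \<open>auto simp: f'\<close>)
  have contf': "continuous_on U f'"
    by (rule continuous_on_blinfun_componentwise) (rule Ck_on_imp_continuous_on[OF Ck'])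
  have lin: "linear (blinfun_apply (f' z))" for z
    using blinfun.bounded_linear_right bounded_linear.linear by blast
  have "linear (f' a)" "inj (f' a)"
    using inj lin[of a] f'[OF assms(2)] by (simp_all add: linear_injective_0)
  then obtain L where L: "linear L" "L \<circ> f' a = id"
    using linear_injective_left_inverse by blast
  have "Blinfun L o\<^sub>L f' a = id_blinfun"
    using L by (intro blinfun_eqI) (simp add: bounded_linear_Blinfun_apply linear_conv_bounded_linear fun_eq_iff)
  then obtain U' V g g' where *: "open U'" "U' \<subseteq> U" "a \<in> U'" "open V" "f a \<in> V" "homeomorphism U' V f g"
    "\<And>y. y \<in> V \<Longrightarrow> (g has_derivative (g' y)) (at y)"
    "\<And>y. y \<in> V \<Longrightarrow> g' y = inv (blinfun_apply (f'(g y)))"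
    "\<And>y. y \<in> V \<Longrightarrow> bij (blinfun_apply (f'(g y)))"
    using inverse_function_theorem[OF \<open>open U\<close> _ contf' assms(2)] der f' by metis
  have gV: "g ` V \<subseteq> U" using * by (auto simp: homeomorphism_def)
  have "Ck_on r g V" for r
  proof (induction r)
    case 0
    then show ?case using *(6) homeomorphism_def by auto
  next
    case (Suc r)
    show ?case
    proof (rule Ck_on_SucI[OF \<open>open V\<close> *(7)])
      show "Ck_on r (\<lambda>y. g' y v) V" for v
      proof (rule Ck_on_inverse_family[OF \<open>open V\<close>, of "\<lambda>y. f' (g y)"])
        show "linear (g' y)" if "y \<in> V" for y
          using *(7)[OF that] has_derivative_linear by blast
        show "g' y (f' (g y) v) = v" "f' (g y) (g' y v) = v" if "y \<in> V" for y v
          using *(9)[OF that] by (auto simp: *(8)[OF that] bij_is_inj bij_is_surj surj_f_inv_f)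
        show "Ck_on r (\<lambda>y. f' (g y) v) V" for v
          by (rule Ck_on_compose[OF \<open>open V\<close> \<open>open U\<close> Ck' Suc gV])
      qed (use lin in auto)
    qed auto
  qed
  then have "smooth_on_open g V" using \<open>open V\<close> by (simp add: smooth_on_open_def)
  then show thesis using * that by blast
qed

text \<open>The inverse function theorem is applied to \<Phi>(x, y) = (x, F(x, y)), whose derivative
  is injective when the partial derivative of \<open>F\<close> in y is. The branch is the second
  component of the inverse at (x, 0); its uniqueness in \<open>T\<close> is injectivity of \<Phi> on
  \<open>U'\<close>.\<close>

lemma smooth_implicit_function:
  fixes F :: "'a::euclidean_space \<times> 'b::euclidean_space \<Rightarrow> 'b"
  assumes "smooth_on_open F U" "(a, b) \<in> U" "F (a, b) = 0"
    and inj: "\<And>w. frechet_derivative F (at (a, b)) (0, w) = 0 \<Longrightarrow> w = 0"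
  obtains S T s where "a \<in> S" "open T" "b \<in> T" "smooth_on_open s S" "s a = b"
    "\<And>x. x \<in> S \<Longrightarrow> s x \<in> T" "S \<times> T \<subseteq> U" "\<And>x. x \<in> S \<Longrightarrow> F (x, s x) = 0"
    "\<And>x y. x \<in> S \<Longrightarrow> y \<in> T \<Longrightarrow> F (x, y) = 0 \<Longrightarrow> y = s x"
proof -
  have "open U" and Ck: "\<And>r. Ck_on r F U" using assms(1) by (auto simp: smooth_on_open_def)
  define \<Phi> where "\<Phi> = (\<lambda>p. (fst p, F p))"
  have smooth: "smooth_on_open \<Phi> U"
    unfolding \<Phi>_def smooth_on_open_def using \<open>open U\<close> Ck
    by (auto intro: Ck_on_Pair Ck_on_bounded_linear bounded_linear_fst)
  have "(\<Phi> has_derivative (\<lambda>v. (fst v, frechet_derivative F (at (a, b)) v))) (at (a, b))"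
    unfolding \<Phi>_def using Ck_on_Suc_has_derivative[OF Ck assms(2)]
    by (intro has_derivative_Pair has_derivative_fst has_derivative_ident)
  from fun_cong[OF frechet_derivative_at[OF this]]
  have "frechet_derivative \<Phi> (at (a, b)) v = (fst v, frechet_derivative F (at (a, b)) v)" for v
    by simp
  then have "frechet_derivative \<Phi> (at (a, b)) v = 0 \<Longrightarrow> v = 0" for v
    using inj[of "snd v"] by (cases v) (auto simp: zero_prod_def)
  from smooth_inverse_function[OF smooth assms(2) this]
  obtain U' V \<Psi> where *: "open U'" "U' \<subseteq> U" "(a, b) \<in> U'" "\<Phi> (a, b) \<in> V" "homeomorphism U' V \<Phi> \<Psi>"
    "smooth_on_open \<Psi> V" by blast
  obtain S0 T where ST: "open S0" "open T" "a \<in> S0" "b \<in> T" "S0 \<times> T \<subseteq> U'"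
    using open_prod_elim[OF *(1,3)] by (metis mem_Sigma_iff)
  have "open V" using *(6) by (simp add: smooth_on_open_def)
  define s where "s x = snd (\<Psi> (x, 0))" for x
  define S1 where "S1 = {x. (x, 0) \<in> V}"
  have "open ((\<lambda>x. (x, 0)) -` V)"
    by (intro open_vimage \<open>open V\<close> continuous_intros)
  then have "open S1" by (simp add: S1_def vimage_def)
  have Cks: "Ck_on r s S1" for r
  proof -
    have pair: "Ck_on r (\<lambda>x. (x, 0)) S1"
      by (rule Ck_on_Pair[OF \<open>open S1\<close> Ck_on_bounded_linear[OF \<open>open S1\<close> bounded_linear_ident]
            Ck_on_const[OF \<open>open S1\<close>]])
    have \<Psi>: "Ck_on r \<Psi> V" "(\<lambda>x. (x, 0)) ` S1 \<subseteq> V"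
      using *(6) by (auto simp: S1_def smooth_on_open_def)
    have "Ck_on r (\<lambda>x. \<Psi> (x, 0)) S1"
      by (rule Ck_on_compose[OF \<open>open S1\<close> \<open>open V\<close> \<Psi>(1) pair \<Psi>(2)])
    then show ?thesis
      unfolding s_def by (rule Ck_on_snd[OF \<open>open S1\<close>])
  qed
  \<comment> \<open>\<open>S0\<close> keeps \<open>S \<times> T\<close> in the domain of
    injectivity, \<open>S1\<close> makes (x, 0) a value of \<Phi>, and the preimage keeps the branch
    inside \<open>T\<close>.\<close>
  define S where "S = S0 \<inter> (S1 \<inter> s -` T)"
  have "open S"
    unfolding S_def using ST \<open>open S1\<close> Ck_on_imp_continuous_on[OF Cks] 
    by (intro open_Int continuous_open_preimage) auto
  have \<Psi>: "\<Psi> (\<Phi> p) = p" if "p \<in> U'" for p using *(5) that by (simp add: homeomorphism_def)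
  have \<Phi>ab: "\<Phi> (a, b) = (a, 0)" by (simp add: \<Phi>_def assms(3))
  have eq: "F (x, s x) = 0" if "x \<in> S" for x
  proof -
    have V: "(x, 0) \<in> V" using that by (simp add: S_def S1_def)
    then have "\<Phi> (\<Psi> (x, 0)) = (x, 0)" using *(5) by (simp add: homeomorphism_def)
    then show ?thesis by (cases "\<Psi> (x, 0)") (auto simp: \<Phi>_def s_def)
  qed
  show thesis
  proof (rule that)
    show "s a = b" using \<Psi>[OF *(3)] by (simp add: s_def \<Phi>ab)
    then show "a \<in> S" using ST *(4) \<Phi>ab by (simp add: S_def S1_def)
    have "S \<subseteq> S1" by (auto simp: S_def)
    then show "smooth_on_open s S"
      unfolding smooth_on_open_def using \<open>open S\<close> Ck_on_subset[OF Cks] by blast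
    show "S \<times> T \<subseteq> U" using ST *(2) by (auto simp: S_def)
    show "y = s x" if "x \<in> S" "y \<in> T" "F (x, y) = 0" for x y
    proof -
      have "(x, y) \<in> U'" using that ST by (auto simp: S_def)
      from \<Psi>[OF this] show ?thesis using that by (simp add: s_def \<Phi>_def)
    qed
  qed (use ST eq in \<open>auto simp: S_def\<close>)
qed

section \<open>Multipliers and the KKT conditions\<close>

text \<open>\<open>T\<close> records, beside the linear combination, the coordinates of \<mu>
  outside \<open>J\<close>. It is then injective on the whole space, and an injective linear map in
  finite dimension is bounded below; for \<mu> supported in \<open>J\<close> the extra component is
  0.\<close>

lemma independent_family_bounded_below:
  fixes v :: "'k::finite \<Rightarrow> 'b::euclidean_space"
  assumes "inj_on v J" "independent (v ` J)"
  obtains c where "c > 0"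
    "\<And>\<mu>::real^'k. (\<And>i. i \<notin> J \<Longrightarrow> \<mu> $ i = 0) \<Longrightarrow> c * norm \<mu> \<le> norm (\<Sum>i\<in>UNIV. \<mu> $ i *\<^sub>R v i)"
proof -
  define T where "T \<mu> = (\<Sum>i\<in>UNIV. \<mu> $ i *\<^sub>R v i, \<chi> i. if i \<in> J then 0 else \<mu> $ i)" for \<mu> :: "real^'k"
  have "linear T"
    by (auto intro!: linearI simp: T_def scaleR_add_left sum.distrib vec_eq_iff scaleR_sum_right)
  moreover have "\<mu> = 0" if "T \<mu> = 0" for \<mu>
  proof -
    have off: "\<mu> $ i = 0" if "i \<notin> J" for i
      using \<open>T \<mu> = 0\<close> that by (auto simp: T_def zero_prod_def vec_eq_iff split: if_splits)
    have "(\<Sum>w\<in>v ` J. (\<mu> $ the_inv_into J v w) *\<^sub>R w) = (\<Sum>i\<in>J. \<mu> $ i *\<^sub>R v i)"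
      by (simp add: sum.reindex[OF assms(1)] the_inv_into_f_f[OF assms(1)])
    also have "\<dots> = (\<Sum>i\<in>UNIV. \<mu> $ i *\<^sub>R v i)"
      by (rule sum.mono_neutral_left) (auto simp: off)
    also have "\<dots> = 0" using \<open>T \<mu> = 0\<close> by (simp add: T_def zero_prod_def)
    finally have "\<mu> $ the_inv_into J v w = 0" if "w \<in> v ` J" for w
      using independentD[OF assms(2), of "v ` J" "\<lambda>w. \<mu> $ the_inv_into J v w" w] that by simp
    then have "\<mu> $ i = 0" if "i \<in> J" for i
      using that the_inv_into_f_f[OF assms(1) that] by force
    then show ?thesis using off by (metis vec_eq_iff zero_index)
  qed
  ultimately obtain c where c: "c > 0" "\<And>\<mu>. c * norm \<mu> \<le> norm (T \<mu>)"
    using linear_inj_bounded_below_pos linear_injective_0 by metis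
  show thesis
  proof (rule that[OF c(1)])
    fix \<mu> :: "real^'k" assume "\<And>i. i \<notin> J \<Longrightarrow> \<mu> $ i = 0"
    then have "T \<mu> = (\<Sum>i\<in>UNIV. \<mu> $ i *\<^sub>R v i, 0)" by (auto simp: T_def vec_eq_iff)
    then show "c * norm \<mu> \<le> norm (\<Sum>i\<in>UNIV. \<mu> $ i *\<^sub>R v i)" using c(2)[of \<mu>] by simp
  qed
qed

text \<open>Once the total perturbation is below half of the lower bound, the other half survives.
  What matters is one constant for all late n: it yields estimates uniform in n.\<close>

lemma independent_family_perturb:
  fixes v :: "'k::finite \<Rightarrow> 'b::euclidean_space" and V :: "nat \<Rightarrow> 'k \<Rightarrow> 'b"
  assumes "inj_on v J" "independent (v ` J)" and V: "\<And>i. (\<lambda>n. V n i) \<longlonglongrightarrow> v i"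
  obtains c where "c > 0"
    "eventually (\<lambda>n. \<forall>\<mu>::real^'k. (\<forall>i. i \<notin> J \<longrightarrow> \<mu> $ i = 0) \<longrightarrow>
       c * norm \<mu> \<le> norm (\<Sum>i\<in>UNIV. \<mu> $ i *\<^sub>R V n i)) sequentially"
proof -
  obtain c where c: "c > 0"
    "\<And>\<mu>::real^'k. (\<And>i. i \<notin> J \<Longrightarrow> \<mu> $ i = 0) \<Longrightarrow> c * norm \<mu> \<le> norm (\<Sum>i\<in>UNIV. \<mu> $ i *\<^sub>R v i)"
    using independent_family_bounded_below[OF assms(1,2)] by metis
  have "(\<lambda>n. \<Sum>i\<in>UNIV. norm (v i - V n i)) \<longlonglongrightarrow> (\<Sum>i\<in>UNIV. norm (v i - v i))"
    by (intro tendsto_intros V)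
  then have "eventually (\<lambda>n. (\<Sum>i\<in>UNIV. norm (v i - V n i)) < c / 2) sequentially"
    using c(1) by (intro order_tendstoD(2)[where y=0]) auto
  then have "eventually (\<lambda>n. \<forall>\<mu>::real^'k. (\<forall>i. i \<notin> J \<longrightarrow> \<mu> $ i = 0) \<longrightarrow>
       c / 2 * norm \<mu> \<le> norm (\<Sum>i\<in>UNIV. \<mu> $ i *\<^sub>R V n i)) sequentially"
  proof eventually_elim
    case (elim n)
    show ?case
    proof (intro allI impI)
      fix \<mu> :: "real^'k" assume off: "\<forall>i. i \<notin> J \<longrightarrow> \<mu> $ i = 0"
      let ?v = "\<Sum>i\<in>UNIV. \<mu> $ i *\<^sub>R v i" and ?V = "\<Sum>i\<in>UNIV. \<mu> $ i *\<^sub>R V n i"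
      have "norm (?v - ?V) = norm (\<Sum>i\<in>UNIV. \<mu> $ i *\<^sub>R (v i - V n i))"
        by (simp add: sum_subtractf scaleR_diff_right)
      also have "\<dots> \<le> (\<Sum>i\<in>UNIV. norm \<mu> * norm (v i - V n i))"
        by (intro sum_norm_le) (auto intro!: mult_right_mono simp: component_le_norm_cart)
      also have "\<dots> \<le> norm \<mu> * (c / 2)"
        unfolding sum_distrib_left[symmetric] using elim by (intro mult_left_mono) auto
      finally have "norm ?v \<le> norm ?V + norm \<mu> * (c / 2)"
        using norm_triangle_sub[of ?v ?V] by linarith
      then show "c / 2 * norm \<mu> \<le> norm ?V"
        using c(2)[of \<mu>] off by (simp add: algebra_simps)
    qed
  qed
  then show thesis using c(1) that[of "c / 2"] by simp
qed

text \<open>Independence is asked of the limit vectors only; the uniform lower bound turns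
  convergence of the combinations into boundedness of \<open>M\<close>. This serves for the penalty
  multipliers as well as for limits of KKT pairs.\<close>

lemma multipliers_subsequence:
  fixes v :: "'k::finite \<Rightarrow> 'b::euclidean_space" and V :: "nat \<Rightarrow> 'k \<Rightarrow> 'b" and M :: "nat \<Rightarrow> real^'k"
  assumes "inj_on v J" "independent (v ` J)" and V: "\<And>i. (\<lambda>n. V n i) \<longlonglongrightarrow> v i"
    and off: "eventually (\<lambda>n. \<forall>i. i \<notin> J \<longrightarrow> M n $ i = 0) sequentially"
    and w: "(\<lambda>n. \<Sum>i\<in>UNIV. M n $ i *\<^sub>R V n i) \<longlonglongrightarrow> w"
  obtains r M0 where "strict_mono r" "(\<lambda>n. M (r n)) \<longlonglongrightarrow> M0" "(\<Sum>i\<in>UNIV. M0 $ i *\<^sub>R v i) = w"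
proof -
  obtain c where c: "c > 0"
    "eventually (\<lambda>n. \<forall>\<mu>::real^'k. (\<forall>i. i \<notin> J \<longrightarrow> \<mu> $ i = 0) \<longrightarrow>
       c * norm \<mu> \<le> norm (\<Sum>i\<in>UNIV. \<mu> $ i *\<^sub>R V n i)) sequentially"
    using independent_family_perturb[OF assms(1-3)] by blast
  have "Bseq (\<lambda>n. \<Sum>i\<in>UNIV. M n $ i *\<^sub>R V n i)"
    by (rule convergent_imp_Bseq[OF convergentI[OF w]])
  then obtain K where "K > 0" and K: "\<forall>n. norm (\<Sum>i\<in>UNIV. M n $ i *\<^sub>R V n i) \<le> K"
    by (rule BseqE)
  have "eventually (\<lambda>n. norm (M n) \<le> K / c) sequentially"
    using c(2) off
  proof eventually_elim
    case (elim n)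
    then have "c * norm (M n) \<le> norm (\<Sum>i\<in>UNIV. M n $ i *\<^sub>R V n i)" by blast
    then show ?case using spec[OF K, of n] c(1) by (simp add: field_simps)
  qed
  then have "bounded (range M)"
    using BfunI Bseq_eq_bounded by blast
  then obtain M0 r where r: "strict_mono r" "(M \<circ> r) \<longlonglongrightarrow> M0"
    using bounded_imp_convergent_subsequence by blast
  then have M: "(\<lambda>n. M (r n)) \<longlonglongrightarrow> M0" by (simp add: o_def)
  have "(\<lambda>n. \<Sum>i\<in>UNIV. M (r n) $ i *\<^sub>R V (r n) i) \<longlonglongrightarrow> (\<Sum>i\<in>UNIV. M0 $ i *\<^sub>R v i)"
    using V LIMSEQ_subseq_LIMSEQ[OF V r(1)] by (intro tendsto_intros M) (simp add: o_def)
  moreover have "(\<lambda>n. \<Sum>i\<in>UNIV. M (r n) $ i *\<^sub>R V (r n) i) \<longlonglongrightarrow> w"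
    using LIMSEQ_subseq_LIMSEQ[OF w r(1)] by (simp add: o_def)
  ultimately show thesis using that r(1) M LIMSEQ_unique by blast
qed

section \<open>First-order necessary conditions by penalization\<close>

text \<open>Squaring the positive part makes the penalty differentiable, so that interior minimizers
  of the penalized objective are stationary; at 0 the difference quotient is at most |h|.\<close>

lemma DERIV_max_0_power2: "DERIV (\<lambda>t. (max 0 t)\<^sup>2) t :> 2 * max 0 (t::real)"
proof -
  consider "t < 0" | "t > 0" | "t = 0" by linarith
  then show ?thesis
  proof cases
    case 1
    have "DERIV (\<lambda>t. 0) t :> 2 * max 0 t" using 1 by (simp add: max_def)
    then show ?thesis by (rule has_field_derivative_transform_within_open[of _ _ _ "{..<0}"]) (use 1 in auto)
  next
    case 2
    have "DERIV (\<lambda>t. t\<^sup>2) t :> 2 * max 0 t" using 2 by (auto intro!: derivative_eq_intros)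
    then show ?thesis by (rule has_field_derivative_transform_within_open[of _ _ _ "{0<..}"]) (use 2 in auto)
  next
    case 3
    have "((\<lambda>h::real. (max 0 h)\<^sup>2 / h) \<longlongrightarrow> 0) (at 0)"
    proof (rule Lim_null_comparison)
      show "eventually (\<lambda>h::real. norm ((max 0 h)\<^sup>2 / h) \<le> \<bar>h\<bar>) (at 0)"
        by (auto simp: max_def power2_eq_square)
    qed (auto intro!: tendsto_eq_intros)
    then show ?thesis using 3 by (simp add: DERIV_def)
  qed
qed

text \<open>Penalty method: the minimisers \<open>z\<^sub>n\<close> of \<open>f + n/2 \<Sum>\<^sub>i (max 0 c\<^sub>i)\<^sup>2 + 1/2 |z - y|\<^sup>2\<close> near \<open>y\<close> converge
  to \<open>y\<close>, and \<open>n max 0 (c\<^sub>i z\<^sub>n)\<close> are approximate multipliers.\<close>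

lemma KKT_necessary:
  fixes f :: "'b::euclidean_space \<Rightarrow> real" and c :: "'k::finite \<Rightarrow> 'b \<Rightarrow> real"
  assumes f: "\<And>z. GDERIV f z :> f' z" and c: "\<And>i z. GDERIV (c i) z :> c' i z"
    and contf': "continuous_on UNIV f'" and contc': "\<And>i. continuous_on UNIV (c' i)"
    and feas: "\<And>i. c i y \<le> 0" and "e > 0"
    and min: "\<And>z. (\<And>i. c i z \<le> 0) \<Longrightarrow> dist z y < e \<Longrightarrow> f y \<le> f z"
    and "inj_on (\<lambda>i. c' i y) {i. c i y = 0}" "independent ((\<lambda>i. c' i y) ` {i. c i y = 0})"
  obtains l :: "real^'k" where "f' y + (\<Sum>i\<in>UNIV. l $ i *\<^sub>R c' i y) = 0"
    "\<And>i. l $ i \<ge> 0" "\<And>i. l $ i * c i y = 0"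
proof -
  have contf: "continuous_on S f" and contc: "continuous_on S (c i)" for S i
    using f c has_derivative_continuous unfolding gderiv_def
    by (blast intro!: continuous_at_imp_continuous_on)+
  \<comment> \<open>Radius e/2 keeps all limits of points of \<open>C\<close> inside the open ball
    of radius \<open>e\<close> where \<open>y\<close> is optimal.\<close>
  define C where "C = cball y (e / 2)"
  define P where "P n z = f z + (\<Sum>i\<in>UNIV. real n / 2 * (max 0 (c i z))\<^sup>2) + (1/2) * ((z - y) \<bullet> (z - y))" for n z
  define P' where "P' n z = f' z + (\<Sum>i\<in>UNIV. (real n * max 0 (c i z)) *\<^sub>R c' i z) + (z - y)" for n z
  have "compact C" "y \<in> C" using \<open>e > 0\<close> by (auto simp: C_def)
  have penalty: "((\<lambda>z. (max 0 (c i z))\<^sup>2) has_derivative (\<lambda>v. v \<bullet> ((2 * max 0 (c i z)) *\<^sub>R c' i z))) (at z)" for i z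
    using GDERIV_DERIV_compose[OF c DERIV_max_0_power2] by (simp add: gderiv_def)
  have P': "(P n has_derivative (\<lambda>v. v \<bullet> P' n z)) (at z)" for n z
  proof -
    have "((\<lambda>z. \<Sum>i\<in>UNIV. real n / 2 * (max 0 (c i z))\<^sup>2) has_derivative
        (\<lambda>v. \<Sum>i\<in>UNIV. real n / 2 * (v \<bullet> ((2 * max 0 (c i z)) *\<^sub>R c' i z)))) (at z)"
      by (intro has_derivative_sum has_derivative_mult_right penalty)
    moreover have "((\<lambda>z. (1/2) * ((z - y) \<bullet> (z - y))) has_derivative (\<lambda>v. v \<bullet> (z - y))) (at z)"
      by (auto intro!: derivative_eq_intros simp: inner_commute)
    ultimately have "(P n has_derivative (\<lambda>v. (v \<bullet> f' z +
        (\<Sum>i\<in>UNIV. real n / 2 * (v \<bullet> ((2 * max 0 (c i z)) *\<^sub>R c' i z)))) + v \<bullet> (z - y))) (at z)"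
      unfolding P_def by (intro has_derivative_add f[unfolded gderiv_def])
    then show ?thesis
      by (simp add: P'_def inner_add_right inner_sum_right mult.assoc)
  qed
  have contP: "continuous_on C (P n)" for n
    using P' has_derivative_continuous by (blast intro: continuous_at_imp_continuous_on)
  obtain z where z: "\<And>n. z n \<in> C" "\<And>n w. w \<in> C \<Longrightarrow> P n (z n) \<le> P n w"
    using continuous_attains_inf[OF \<open>compact C\<close> _ contP] \<open>y \<in> C\<close> by (metis empty_iff)
  obtain m where m: "\<And>w. w \<in> C \<Longrightarrow> m \<le> f w"
    using continuous_attains_inf[OF \<open>compact C\<close> _ contf] \<open>y \<in> C\<close> by (metis empty_iff)
  obtain r zz where r: "strict_mono r" "(z \<circ> r) \<longlonglongrightarrow> zz" and "zz \<in> C"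
    using \<open>compact C\<close> z(1) unfolding compact_def by metis
  then have zr: "(\<lambda>n. z (r n)) \<longlonglongrightarrow> zz" by (simp add: o_def)
  have Py: "P n (z n) \<le> f y" for n
    using z(2)[OF \<open>y \<in> C\<close>, of n] by (simp add: P_def max_absorb1[OF feas])
  have "max 0 (c i zz) = 0" for i
  proof -
    \<comment> \<open>The value of \<open>P n\<close> at its minimizer is at most
      \<open>f y\<close>, and \<open>f\<close> is at least \<open>m\<close> on \<open>C\<close>, so
      the whole penalty is at most f y - m; each squared violation is therefore O(1/n).\<close>
    have le: "(max 0 (c i (z n)))\<^sup>2 \<le> 2 * (f y - m) * (1 / real n)" if "n > 0" for n
    proof -
      have "real n / 2 * (max 0 (c i (z n)))\<^sup>2 \<le> (\<Sum>i\<in>UNIV. real n / 2 * (max 0 (c i (z n)))\<^sup>2)"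
        by (rule member_le_sum) auto
      also have "\<dots> \<le> f y - m"
        using Py[of n] m[OF z(1)[of n]] inner_ge_zero[of "z n - y"] unfolding P_def by linarith
      finally show ?thesis using that by (simp add: field_simps)
    qed
    have "(\<lambda>n. 1 / real (r n)) \<longlonglongrightarrow> 0"
      using LIMSEQ_subseq_LIMSEQ[OF lim_1_over_n r(1)] by (simp add: o_def)
    then have lim0: "(\<lambda>n. 2 * (f y - m) * (1 / real (r n))) \<longlonglongrightarrow> 2 * (f y - m) * 0"
      by (rule tendsto_mult_left)
    have lim1: "(\<lambda>n. (max 0 (c i (z (r n))))\<^sup>2) \<longlonglongrightarrow> (max 0 (c i zz))\<^sup>2"
      by (intro tendsto_power tendsto_max tendsto_const continuous_on_tendsto_compose[OF contc[of UNIV] zr]) auto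
    have "eventually (\<lambda>n. (max 0 (c i (z (r n))))\<^sup>2 \<le> 2 * (f y - m) * (1 / real (r n))) sequentially"
    proof (rule eventually_sequentiallyI[of 1])
      fix n :: nat assume "n \<ge> 1"
      then have "r n > 0" using seq_suble[OF r(1), of n] by linarith
      then show "(max 0 (c i (z (r n))))\<^sup>2 \<le> 2 * (f y - m) * (1 / real (r n))" by (intro le)
    qed
    from tendsto_le[OF trivial_limit_sequentially lim0 lim1 this]
    have "(max 0 (c i zz))\<^sup>2 \<le> 0" by simp
    then show ?thesis by simp
  qed
  then have "c i zz \<le> 0" for i by (metis max.cobounded2)
  then have fyz: "f y \<le> f zz"
    using \<open>zz \<in> C\<close> \<open>e > 0\<close> by (intro min) (auto simp: C_def dist_commute)
  have fz: "(\<lambda>n. f (z (r n))) \<longlonglongrightarrow> f zz"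
    by (rule continuous_on_tendsto_compose[OF contf[of UNIV] zr]) auto
  \<comment> \<open>The quadratic term isolates \<open>y\<close>: the limit \<open>zz\<close> is
    feasible, so f y <= f zz, and the inequality below leaves no room for |zz - y| > 0.\<close>
  have "f zz + (1/2) * ((zz - y) \<bullet> (zz - y)) \<le> f y"
  proof (rule tendsto_upperbound)
    show "(\<lambda>n. f (z (r n)) + (1/2) * ((z (r n) - y) \<bullet> (z (r n) - y))) \<longlonglongrightarrow> f zz + (1/2) * ((zz - y) \<bullet> (zz - y))"
      by (intro tendsto_intros fz zr)
    have "f (z n) + (1/2) * ((z n - y) \<bullet> (z n - y)) \<le> f y" for n
    proof -
      have "(\<Sum>i\<in>UNIV. real n / 2 * (max 0 (c i (z n)))\<^sup>2) \<ge> 0" by (intro sum_nonneg) auto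
      then show ?thesis using Py[of n] by (simp add: P_def)
    qed
    then show "eventually (\<lambda>n. f (z (r n)) + (1/2) * ((z (r n) - y) \<bullet> (z (r n) - y)) \<le> f y) sequentially"
      by simp
  qed auto
  then have "\<not> 0 < (zz - y) \<bullet> (zz - y)" using fyz by linarith
  then have "zz = y" by (metis inner_gt_zero_iff right_minus_eq)
  define M :: "nat \<Rightarrow> real^'k" where "M n = (\<chi> i. real (r n) * max 0 (c i (z (r n))))" for n
  \<comment> \<open>Converging to the centre, the minimizers leave the boundary of \<open>C\<close>
    and become stationary points of the penalized objective.\<close>
  have "eventually (\<lambda>n. z (r n) \<in> ball y (e / 2)) sequentially"
    using tendstoD[OF zr, of "e / 2"] \<open>zz = y\<close> \<open>e > 0\<close> by (simp add: dist_commute)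
  then have stat: "eventually (\<lambda>n. - f' (z (r n)) - (z (r n) - y) = (\<Sum>i\<in>UNIV. M n $ i *\<^sub>R c' i (z (r n)))) sequentially"
  proof eventually_elim
    case (elim n)
    have "(\<lambda>v. v \<bullet> P' (r n) (z (r n))) = (\<lambda>v. 0)"
      using z(2) by (intro differential_zero_maxmin[OF elim open_ball P']) (auto simp: C_def)
    from fun_cong[OF this, of "P' (r n) (z (r n))"] have "P' (r n) (z (r n)) = 0" by simp
    moreover have "(\<Sum>i\<in>UNIV. M n $ i *\<^sub>R c' i (z (r n))) = P' (r n) (z (r n)) - f' (z (r n)) - (z (r n) - y)"
      by (simp add: P'_def M_def)
    ultimately show ?case by simp
  qed
  have lim: "(\<lambda>n. - f' (z (r n)) - (z (r n) - y)) \<longlonglongrightarrow> - f' y - (zz - y)"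
    using continuous_on_tendsto_compose[OF contf' zr] \<open>zz = y\<close> by (intro tendsto_intros zr) auto
  \<comment> \<open>A constraint inactive at \<open>y\<close> stays strictly negative near
    \<open>y\<close>, where its penalty is flat; this confines \<open>M\<close> to the active
    indices, as the compactness of multipliers requires.\<close>
  have inact: "eventually (\<lambda>n. M n $ i = 0) sequentially" if "c i y < 0" for i
  proof -
    have "(\<lambda>n. c i (z (r n))) \<longlonglongrightarrow> c i y"
      using continuous_on_tendsto_compose[OF contc[of UNIV] zr] \<open>zz = y\<close> by auto
    from order_tendstoD(2)[OF this that] show ?thesis
      by (rule eventually_mono) (auto simp: M_def max_def)
  qed
  have "eventually (\<lambda>n. \<forall>i\<in>{i. c i y < 0}. M n $ i = 0) sequentially"
    by (intro eventually_ball_finite ballI inact) auto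
  then have off: "eventually (\<lambda>n. \<forall>i. i \<notin> {i. c i y = 0} \<longrightarrow> M n $ i = 0) sequentially"
    by (rule eventually_mono) (auto simp: less_le feas)
  obtain s l where s: "strict_mono s" "(\<lambda>n. M (s n)) \<longlonglongrightarrow> l" "(\<Sum>i\<in>UNIV. l $ i *\<^sub>R c' i y) = - f' y"
  proof (rule multipliers_subsequence[OF assms(8,9) _ off])
    show "(\<lambda>n. c' i (z (r n))) \<longlonglongrightarrow> c' i y" for i
      using continuous_on_tendsto_compose[OF contc' zr, of i] \<open>zz = y\<close> by simp
    show "(\<lambda>n. \<Sum>i\<in>UNIV. M n $ i *\<^sub>R c' i (z (r n))) \<longlonglongrightarrow> - f' y"
      using Lim_transform_eventually[OF lim stat] \<open>zz = y\<close> by simp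
  qed blast
  have li: "(\<lambda>n. M (s n) $ i) \<longlonglongrightarrow> l $ i" for i using s(2) by (rule tendsto_vec_nth)
  show thesis
  proof (rule that)
    show "f' y + (\<Sum>i\<in>UNIV. l $ i *\<^sub>R c' i y) = 0" by (simp add: s(3))
    show "l $ i \<ge> 0" for i
      by (rule tendsto_lowerbound[OF li]) (auto simp: M_def)
    show "l $ i * c i y = 0" for i
    proof (cases "c i y = 0")
      case False
      then have "c i y < 0" using feas[of i] by simp
      have "eventually (\<lambda>n. M (s n) $ i = 0) sequentially"
        using eventually_subseq[OF s(1) inact[OF \<open>c i y < 0\<close>]] .
      from LIMSEQ_unique[OF li tendsto_eventually[OF this]] show ?thesis by simp
    qed simp
  qed
qed

section \<open>Partial gradients and Hessians\<close>

lemma grad_eqI: "GDERIV f y :> D \<Longrightarrow> grad f y = D"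
proof -
  assume D: "GDERIV f y :> D"
  have "D' = D" if "GDERIV f y :> D'" for D'
    using fun_cong[OF has_derivative_unique[OF that[unfolded gderiv_def] D[unfolded gderiv_def]]]
    by (metis vector_eq_ldot)
  with D show ?thesis unfolding grad_def by (intro the_equality)
qed

text \<open>The gradient in the second variable, read off from the full derivative so that joint
  smoothness in both variables is inherited from \<open>G\<close>.\<close>

definition partial_grad :: "('a::euclidean_space \<times> 'b::euclidean_space \<Rightarrow> real) \<Rightarrow> 'a \<times> 'b \<Rightarrow> 'b" where
  "partial_grad G p = (\<Sum>b\<in>Basis. frechet_derivative G (at p) (0, b) *\<^sub>R b)"

lemma GDERIV_partial_grad:
  assumes "G differentiable (at (x, y))"
  shows "GDERIV (\<lambda>z. G (x, z)) y :> partial_grad G (x, y)"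
proof -
  let ?G' = "frechet_derivative G (at (x, y))"
  have G': "(G has_derivative ?G') (at (x, y))"
    using assms frechet_derivative_works by blast
  have "((\<lambda>z. (x, z)) has_derivative (\<lambda>v. (0, v))) (at y)"
    by (intro has_derivative_Pair has_derivative_const has_derivative_ident)
  from has_derivative_compose[OF this G']
  have "((\<lambda>z. G (x, z)) has_derivative (\<lambda>v. ?G' (0, v))) (at y)" .
  moreover have "linear (\<lambda>v. ?G' (0, v))"
    using calculation has_derivative_linear by blast
  then have "?G' (0, v) = v \<bullet> partial_grad G (x, y)" for v
    using linear_eq_sum_Basis[of "\<lambda>v. ?G' (0, v)" v]
    by (simp add: partial_grad_def inner_sum_right mult.commute)
  ultimately show ?thesis by (simp add: gderiv_def)
qed

lemma smooth_on_open_partial_grad: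
  assumes "smooth_on_open G U"
  shows "smooth_on_open (partial_grad G) U"
  unfolding smooth_on_open_def
proof (intro conjI allI)
  show "open U" using assms by (simp add: smooth_on_open_def)
  fix r
  have "Ck_on (Suc r) G U" using assms by (simp add: smooth_on_open_def del: Ck_on.simps)
  then show "Ck_on r (partial_grad G) U"
    unfolding partial_grad_def[abs_def]
    by (intro Ck_on_sum Ck_on_linear_compose[OF \<open>open U\<close> bounded_linear_scaleR_left] \<open>open U\<close>) auto
qed

lemma smooth_on_open_has_derivative:
  "smooth_on_open G U \<Longrightarrow> p \<in> U \<Longrightarrow> (G has_derivative frechet_derivative G (at p)) (at p)"
  unfolding smooth_on_open_def using Ck_on_Suc_has_derivative by blast

lemma smooth_on_open_continuous_on: "smooth_on_open G U \<Longrightarrow> continuous_on U G"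
  by (metis Ck_on_imp_continuous_on smooth_on_open_def)

lemma smooth_on_open_directional:
  "smooth_on_open G U \<Longrightarrow> smooth_on_open (\<lambda>p. frechet_derivative G (at p) v) U"
  by (metis Ck_on.simps(2) smooth_on_open_def)

lemma smooth_on_open_subset:
  "smooth_on_open G U \<Longrightarrow> open V \<Longrightarrow> V \<subseteq> U \<Longrightarrow> smooth_on_open G V"
  unfolding smooth_on_open_def using Ck_on_subset by blast

text \<open>Transfers continuity from local smooth extensions to the function they extend; each
  point may use an extension of its own.\<close>

lemma continuous_on_locally_equal:
  fixes f :: "'a::t2_space \<Rightarrow> 'b::topological_space"
  assumes "\<And>p. p \<in> S \<Longrightarrow> \<exists>U g. open U \<and> p \<in> U \<and> continuous_on U g \<and> (\<forall>q\<in>S \<inter> U. f q = g q)"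
  shows "continuous_on S f"
  unfolding continuous_on_def
proof
  fix p assume "p \<in> S"
  then obtain U g where U: "open U" "p \<in> U" "continuous_on U g" "\<forall>q\<in>S \<inter> U. f q = g q"
    using assms by blast
  have "isCont g p" using U(1-3) continuous_on_eq_continuous_at by blast
  then have "(g \<longlongrightarrow> g p) (at p within S)"
    unfolding isCont_def by (rule tendsto_within_subset) simp
  then have lim: "(g \<longlongrightarrow> f p) (at p within S)" using U(2,4) \<open>p \<in> S\<close> by simp
  have "eventually (\<lambda>q. q \<in> U) (at p within S)"
    using U(1,2) eventually_at_topological by blast
  then have "eventually (\<lambda>q. g q = f q) (at p within S)"
    unfolding eventually_at_filter by (rule eventually_mono) (use U(4) in auto)
  then show "(f \<longlongrightarrow> f p) (at p within S)" by (rule Lim_transform_eventually[OF lim])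
qed

text \<open>\<open>G\<close> is an extension of \<open>f\<close> around part of
  \<open>X \<times> UNIV\<close>. The slices of \<open>U\<close> in the second variable are open, so
  \<open>G\<close> and \<open>f x\<close> have the same derivatives in y for x in \<open>X\<close>,
  however thin \<open>X\<close> is; derivatives in x belong to \<open>G\<close> alone.\<close>

locale smooth_extension =
  fixes f :: "'a::euclidean_space \<Rightarrow> real^'m \<Rightarrow> real" and G U X
  assumes smooth: "smooth_on_open G U"
    and eq: "\<And>x y. x \<in> X \<Longrightarrow> (x, y) \<in> U \<Longrightarrow> G (x, y) = f x y"
begin

lemma open_slice: "open {z. (x, z) \<in> U}"
proof -
  have "open U" using smooth by (simp add: smooth_on_open_def)
  then have "open ((\<lambda>z. (x, z)) -` U)" by (intro open_vimage continuous_intros)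
  then show ?thesis by (simp add: vimage_def)
qed

lemma GDERIV_partial:
  assumes "x \<in> X" "(x, y) \<in> U"
  shows "GDERIV (f x) y :> partial_grad G (x, y)"
proof -
  have "G differentiable (at (x, y))"
    using smooth_on_open_has_derivative[OF smooth assms(2)] differentiableI by blast
  then have "GDERIV (\<lambda>z. G (x, z)) y :> partial_grad G (x, y)" by (rule GDERIV_partial_grad)
  then show ?thesis
    unfolding gderiv_def
    by (rule has_derivative_transform_within_open[OF _ open_slice]) (use assms eq in auto)
qed

lemma grad_eq: "x \<in> X \<Longrightarrow> (x, y) \<in> U \<Longrightarrow> grad (f x) y = partial_grad G (x, y)"
  by (intro grad_eqI GDERIV_partial)

lemma has_derivative_grad:
  assumes "x \<in> X" "(x, y) \<in> U"
  shows "(grad (f x) has_derivative (\<lambda>d. frechet_derivative (partial_grad G) (at (x, y)) (0, d))) (at y)"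
proof -
  have "((\<lambda>z. (x, z)) has_derivative (\<lambda>v. (0, v))) (at y)"
    by (intro has_derivative_Pair has_derivative_const has_derivative_ident)
  from has_derivative_compose[OF this smooth_on_open_has_derivative[OF smooth_on_open_partial_grad[OF smooth] assms(2)]]
  have "((\<lambda>z. partial_grad G (x, z)) has_derivative
     (\<lambda>d. frechet_derivative (partial_grad G) (at (x, y)) (0, d))) (at y)" .
  then show ?thesis
    by (rule has_derivative_transform_within_open[OF _ open_slice]) (use assms grad_eq in auto)
qed

lemma hessian_eq:
  assumes "x \<in> X" "(x, y) \<in> U"
  shows "(grad (f x) has_derivative (*v) (hessian (f x) y)) (at y)"
    and "hessian (f x) y *v d = frechet_derivative (partial_grad G) (at (x, y)) (0, d)"
proof -
  show *: "(grad (f x) has_derivative (*v) (hessian (f x) y)) (at y)"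
    unfolding hessian_def using has_derivative_grad[OF assms] jacobian_works differentiableI by blast
  show "hessian (f x) y *v d = frechet_derivative (partial_grad G) (at (x, y)) (0, d)"
    using fun_cong[OF has_derivative_unique[OF * has_derivative_grad[OF assms]]] .
qed

end

lemma smooth_map_on_extension:
  assumes "smooth_map_on (\<lambda>(x, y). f x y) (X \<times> UNIV)" "x \<in> X"
  obtains G U where "smooth_extension f G U X" "(x, y) \<in> U"
proof -
  have "(x, y) \<in> X \<times> UNIV" using assms(2) by simp
  then obtain U F where "(x, y) \<in> U" "smooth_on_open F U"
    "\<forall>p\<in>U \<inter> X \<times> UNIV. F p = (case p of (x, y) \<Rightarrow> f x y)"
    using assms(1) unfolding smooth_map_on_def by blast
  then show thesis by (intro that[of F U]) (auto simp: smooth_extension_def)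
qed

lemma
  assumes f: "smooth_map_on (\<lambda>(x, y). f x y) (X \<times> UNIV)"
  shows smooth_map_on_GDERIV: "x \<in> X \<Longrightarrow> GDERIV (f x) y :> grad (f x) y"
    and smooth_map_on_has_derivative_grad:
      "x \<in> X \<Longrightarrow> (grad (f x) has_derivative (*v) (hessian (f x) y)) (at y)"
    and smooth_map_on_continuous: "continuous_on (X \<times> UNIV) (\<lambda>(x, y). f x y)"
    and smooth_map_on_continuous_grad: "continuous_on (X \<times> UNIV) (\<lambda>(x, y). grad (f x) y)"
    and smooth_map_on_continuous_hessian: "continuous_on (X \<times> UNIV) (\<lambda>(x, y). hessian (f x) y *v d)"
proof -
  have "\<exists>G U. smooth_extension f G U X \<and> (x, y) \<in> U" if "x \<in> X" for x y
    using smooth_map_on_extension[OF f that] by metis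
  then obtain G U where ext: "\<And>x y. x \<in> X \<Longrightarrow> smooth_extension f (G x y) (U x y) X"
      and mem: "\<And>x y. x \<in> X \<Longrightarrow> (x, y) \<in> U x y"
    by metis
  note smooth = smooth_extension.smooth[OF ext]
  have op: "open (U x y)" if "x \<in> X" for x y using smooth[OF that] smooth_on_open_def by blast
  show "GDERIV (f x) y :> grad (f x) y" if "x \<in> X"
    using smooth_extension.GDERIV_partial[OF ext] smooth_extension.grad_eq[OF ext] mem that by metis
  show "(grad (f x) has_derivative (*v) (hessian (f x) y)) (at y)" if "x \<in> X"
    using smooth_extension.hessian_eq(1)[OF ext] mem that by metis
  show "continuous_on (X \<times> UNIV) (\<lambda>(x, y). f x y)"
  proof (rule continuous_on_locally_equal, safe)
    fix x y assume x: "x \<in> X"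
    have "\<forall>q\<in>X \<times> UNIV \<inter> U x y. (case q of (x, y) \<Rightarrow> f x y) = G x y q"
      using smooth_extension.eq[OF ext[OF x]] by auto
    then show "\<exists>V g. open V \<and> (x, y) \<in> V \<and> continuous_on V g \<and>
        (\<forall>q\<in>X \<times> UNIV \<inter> V. (case q of (x, y) \<Rightarrow> f x y) = g q)"
      using op[OF x] mem[OF x] smooth_on_open_continuous_on[OF smooth[OF x]] by blast
  qed
  show "continuous_on (X \<times> UNIV) (\<lambda>(x, y). grad (f x) y)"
  proof (rule continuous_on_locally_equal, safe)
    fix x y assume x: "x \<in> X"
    have "\<forall>q\<in>X \<times> UNIV \<inter> U x y. (case q of (x, y) \<Rightarrow> grad (f x) y) = partial_grad (G x y) q"
      using smooth_extension.grad_eq[OF ext[OF x]] by auto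
    then show "\<exists>V g. open V \<and> (x, y) \<in> V \<and> continuous_on V g \<and>
        (\<forall>q\<in>X \<times> UNIV \<inter> V. (case q of (x, y) \<Rightarrow> grad (f x) y) = g q)"
      using op[OF x] mem[OF x] smooth_on_open_continuous_on[OF smooth_on_open_partial_grad[OF smooth[OF x]]] by blast
  qed
  show "continuous_on (X \<times> UNIV) (\<lambda>(x, y). hessian (f x) y *v d)"
  proof (rule continuous_on_locally_equal, safe)
    fix x y assume x: "x \<in> X"
    have "\<forall>q\<in>X \<times> UNIV \<inter> U x y. (case q of (x, y) \<Rightarrow> hessian (f x) y *v d) =
        frechet_derivative (partial_grad (G x y)) (at q) (0, d)"
      using smooth_extension.hessian_eq(2)[OF ext[OF x]] by auto
    then show "\<exists>V g. open V \<and> (x, y) \<in> V \<and> continuous_on V g \<and>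
        (\<forall>q\<in>X \<times> UNIV \<inter> V. (case q of (x, y) \<Rightarrow> hessian (f x) y *v d) = g q)"
      using op[OF x] mem[OF x] smooth_on_open_continuous_on[OF
          smooth_on_open_directional[OF smooth_on_open_partial_grad[OF smooth[OF x]], where v = "(0, d)"]]
      by (intro exI[of _ "U x y"] exI[of _ "\<lambda>q. frechet_derivative (partial_grad (G x y)) (at q) (0, d)"] conjI)
  qed
qed

text \<open>Continuity of the Hessian is available for each fixed direction; expansion in the
  standard basis lets the direction converge as well.\<close>

lemma tendsto_hessian_mult:
  fixes M :: "nat \<Rightarrow> real^'m^'n"
  assumes "\<And>d. (\<lambda>n. M n *v d) \<longlonglongrightarrow> A *v d" "(\<lambda>n. D n) \<longlonglongrightarrow> d"
  shows "(\<lambda>n. M n *v D n) \<longlonglongrightarrow> A *v d"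
proof -
  have *: "B *v e = (\<Sum>i\<in>UNIV. e $ i *\<^sub>R (B *v axis i 1))" for B :: "real^'m^'n" and e
    unfolding matrix_mult_sum[of B e] by (simp add: matrix_vector_mult_basis scalar_mult_eq_scaleR)
  show ?thesis
    unfolding *[of _ "D _"] *[of A d] by (intro tendsto_intros assms)
qed

section \<open>Limits of KKT pairs and second-order conditions\<close>

text \<open>Turns counterexamples chosen at every scale 1/(n+1) into a convergent sequence.\<close>

lemma LIMSEQ_inverse_Suc:
  assumes "\<And>n. dist (z n) y < 1 / real (Suc n)"
  shows "z \<longlonglongrightarrow> y"
  by (rule metric_tendsto_imp_tendsto[OF LIMSEQ_Suc[OF lim_1_over_n[where 'a = real]]])
    (use less_imp_le[OF assms] in \<open>simp add: dist_real_def\<close>)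

text \<open>The Hessian of the Lagrangian in y, split into its summands so that limits in (x, y, l)
  can be taken term by term; \<open>hessian_lagrangian\<close> proves the agreement.\<close>

definition hess_lagr ::
  "(real^'n \<Rightarrow> real^'m \<Rightarrow> real) \<Rightarrow> ('k::finite \<Rightarrow> real^'n \<Rightarrow> real^'m \<Rightarrow> real) \<Rightarrow>
   real^'n \<Rightarrow> real^'m \<Rightarrow> real^'k \<Rightarrow> real^'m \<Rightarrow> real^'m" where
  "hess_lagr g h x y l d = hessian (g x) y *v d + (\<Sum>i\<in>UNIV. l $ i *\<^sub>R (hessian (h i x) y *v d))"

text \<open>Coercivity on the tangent space of the active constraints. Under SCSC this space is the
  critical cone at a KKT pair; being linear, it admits orthogonal projections.\<close>

definition second_order ::
  "(real^'n \<Rightarrow> real^'m \<Rightarrow> real) \<Rightarrow> ('k::finite \<Rightarrow> real^'n \<Rightarrow> real^'m \<Rightarrow> real) \<Rightarrow>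
   real \<Rightarrow> real^'n \<Rightarrow> real^'m \<Rightarrow> real^'k \<Rightarrow> bool" where
  "second_order g h \<sigma> x y l \<longleftrightarrow> (\<forall>d. (\<forall>i\<in>active h x y. grad (h i x) y \<bullet> d = 0) \<longrightarrow>
     \<sigma> * (norm d)\<^sup>2 \<le> d \<bullet> hess_lagr g h x y l d)"

section \<open>Growth along sequences of points\<close>

text \<open>The mean value theorem on the segment from \<open>y\<close> to \<open>z\<close>
  expresses the increment of \<open>L\<close> through \<open>L'\<close> at an intermediate point,
  where linearizing \<open>L'\<close> brings in \<open>H\<close>. The unknown \<open>s\<close>
  stands in for the Taylor factor 1/2; only 0 < s <= 1 is used later.\<close>

lemma second_order_growth:
  fixes L :: "'a::real_inner \<Rightarrow> real"
  assumes L: "\<And>z. GDERIV L z :> L' z" and "L' y = 0" and H: "(L' has_derivative H) (at y)" and "e > 0"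
  obtains \<delta> where "\<delta> > 0"
    "\<And>z. norm (z - y) < \<delta> \<Longrightarrow> \<exists>s\<in>{0<..1}. s * ((z - y) \<bullet> H (z - y) - e * (norm (z - y))\<^sup>2) \<le> L z - L y"
proof -
  obtain \<delta> where \<delta>: "\<delta> > 0" "\<And>w. norm (w - y) < \<delta> \<Longrightarrow> norm (L' w - H (w - y)) \<le> e * norm (w - y)"
    using H \<open>e > 0\<close> \<open>L' y = 0\<close> unfolding has_derivative_within_alt by (auto simp del: norm_minus_commute)
  have "\<exists>s\<in>{0<..1}. s * ((z - y) \<bullet> H (z - y) - e * (norm (z - y))\<^sup>2) \<le> L z - L y"
    if z: "norm (z - y) < \<delta>" for z
  proof -
    define d where "d = z - y"
    have "((\<lambda>s. L (y + s *\<^sub>R d)) has_derivative (\<lambda>t. (t *\<^sub>R d) \<bullet> L' (y + s *\<^sub>R d))) (at s within {0..1})"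
      for s :: real
    proof -
      have "((\<lambda>s. y + s *\<^sub>R d) has_derivative (\<lambda>t. t *\<^sub>R d)) (at s within {0..1})"
        by (auto intro!: derivative_eq_intros)
      from has_derivative_compose[OF this L[unfolded gderiv_def]] show ?thesis .
    qed
    then have "\<exists>s\<in>{0<..<1}. L (y + 1 *\<^sub>R d) - L (y + 0 *\<^sub>R d) = ((1 - 0) *\<^sub>R d) \<bullet> L' (y + s *\<^sub>R d)"
      by (intro mvt_simple) auto
    then obtain s where s: "0 < s" "s < 1" "L z - L y = d \<bullet> L' (y + s *\<^sub>R d)"
      by (auto simp: d_def)
    define R where "R = L' (y + s *\<^sub>R d) - H (s *\<^sub>R d)"
    have "norm (s *\<^sub>R d) < \<delta>"
      using z s(1,2) mult_left_le_one_le[of "norm d" s] by (simp add: d_def)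
    then have R: "norm R \<le> e * (s * norm d)"
      using \<delta>(2)[of "y + s *\<^sub>R d"] s(1) by (simp add: R_def)
    have "- (d \<bullet> R) \<le> norm d * norm R" using norm_cauchy_schwarz[of "-d" R] by simp
    also have "\<dots> \<le> norm d * (e * (s * norm d))" by (rule mult_left_mono[OF R]) simp
    finally have "- s * e * (norm d)\<^sup>2 \<le> d \<bullet> R" by (simp add: power2_eq_square mult_ac)
    moreover have "H (s *\<^sub>R d) = s *\<^sub>R H d"
      using has_derivative_linear[OF H] by (simp add: linear_cmul)
    then have "L z - L y = s * (d \<bullet> H d) + d \<bullet> R"
      using s(3) by (simp add: R_def inner_diff_right)
    ultimately show ?thesis using s(1,2)
      by (intro bexI[of _ s]) (auto simp: d_def right_diff_distrib mult.assoc)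
  qed
  then show thesis using that \<delta>(1) by blast
qed

lemma directional_quotient_tendsto:
  fixes f :: "'a::real_inner \<Rightarrow> real"
  assumes f: "GDERIV f y :> D" and z: "z \<longlonglongrightarrow> y" "\<And>n. z n \<noteq> y"
    and d: "(\<lambda>n. (z n - y) /\<^sub>R norm (z n - y)) \<longlonglongrightarrow> d"
  shows "(\<lambda>n. (f (z n) - f y) / norm (z n - y)) \<longlonglongrightarrow> d \<bullet> D"
proof -
  have "((\<lambda>w. norm ((f w - f y) - (w - y) \<bullet> D) / norm (w - y)) \<longlongrightarrow> 0) (at y)"
    using f unfolding gderiv_def has_derivative_iff_norm by blast
  moreover have "filterlim z (at y) sequentially"
    using z by (simp add: filterlim_at)
  ultimately have "(\<lambda>n. norm ((f (z n) - f y) - (z n - y) \<bullet> D) / norm (z n - y)) \<longlonglongrightarrow> 0"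
    by (rule filterlim_compose)
  then have "(\<lambda>n. norm (((f (z n) - f y) - (z n - y) \<bullet> D) / norm (z n - y))) \<longlonglongrightarrow> 0"
    by simp
  then have "(\<lambda>n. ((f (z n) - f y) - (z n - y) \<bullet> D) / norm (z n - y)) \<longlonglongrightarrow> 0"
    by (rule tendsto_norm_zero_cancel)
  moreover have "(\<lambda>n. ((z n - y) /\<^sub>R norm (z n - y)) \<bullet> D) \<longlonglongrightarrow> d \<bullet> D"
    by (intro tendsto_intros d)
  ultimately have "(\<lambda>n. ((f (z n) - f y) - (z n - y) \<bullet> D) / norm (z n - y) +
      ((z n - y) /\<^sub>R norm (z n - y)) \<bullet> D) \<longlonglongrightarrow> 0 + d \<bullet> D"
    by (rule tendsto_add)
  moreover have "((f (z n) - f y) - (z n - y) \<bullet> D) / norm (z n - y) + ((z n - y) /\<^sub>R norm (z n - y)) \<bullet> D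
      = (f (z n) - f y) / norm (z n - y)" for n
    unfolding inner_scaleR_left divide_inverse by (simp add: algebra_simps)
  ultimately show ?thesis by simp
qed

section \<open>The parametric problem and limits of its KKT pairs\<close>

text \<open>Only the assumptions on the optimization data; the topology of \<open>X\<close> enters
  separately, in the lifting argument.\<close>

locale lower_level_problem =
  fixes X :: "(real^'n) set"
    and g :: "real^'n \<Rightarrow> real^'m \<Rightarrow> real"
    and h :: "'k::finite \<Rightarrow> real^'n \<Rightarrow> real^'m \<Rightarrow> real"
  assumes smooth_g: "smooth_map_on (\<lambda>(x, y). g x y) (X \<times> UNIV)"
    and smooth_h: "\<And>i. smooth_map_on (\<lambda>(x, y). h i x y) (X \<times> UNIV)"
    and nonempty: "\<And>x. x \<in> X \<Longrightarrow> feasible h x \<noteq> {}"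
    and bounded: "uniformly_bounded h X"
    and LICQ: "\<And>x. x \<in> X \<Longrightarrow> LICQ h x"
    and SCSC: "\<And>x. x \<in> X \<Longrightarrow> SCSC g h x"
    and SOSC: "uniform_SOSC g h X"
begin

lemma tendsto_problem:
  assumes "\<And>n. xs n \<in> X" "xs \<longlonglongrightarrow> x" "x \<in> X" "ys \<longlonglongrightarrow> y"
  shows "(\<lambda>n. g (xs n) (ys n)) \<longlonglongrightarrow> g x y"
    and "(\<lambda>n. h i (xs n) (ys n)) \<longlonglongrightarrow> h i x y"
    and "(\<lambda>n. grad (g (xs n)) (ys n)) \<longlonglongrightarrow> grad (g x) y"
    and "(\<lambda>n. grad (h i (xs n)) (ys n)) \<longlonglongrightarrow> grad (h i x) y"
    and "(\<lambda>n. hessian (g (xs n)) (ys n) *v d) \<longlonglongrightarrow> hessian (g x) y *v d"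
    and "(\<lambda>n. hessian (h i (xs n)) (ys n) *v d) \<longlonglongrightarrow> hessian (h i x) y *v d"
proof -
  have xy: "(\<lambda>n. (xs n, ys n)) \<longlonglongrightarrow> (x, y)" using assms by (intro tendsto_Pair)
  have *: "(\<lambda>n. F (xs n) (ys n)) \<longlonglongrightarrow> F x y" if "continuous_on (X \<times> UNIV) (\<lambda>(x, y). F x y)"
    for F :: "real^'n \<Rightarrow> real^'m \<Rightarrow> 'c::topological_space"
    using continuous_on_tendsto_compose[OF that xy] assms(1,3) by simp
  show "(\<lambda>n. g (xs n) (ys n)) \<longlonglongrightarrow> g x y"
    by (rule *[OF smooth_map_on_continuous[OF smooth_g]])
  show "(\<lambda>n. h i (xs n) (ys n)) \<longlonglongrightarrow> h i x y"
    by (rule *[OF smooth_map_on_continuous[OF smooth_h]])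
  show "(\<lambda>n. grad (g (xs n)) (ys n)) \<longlonglongrightarrow> grad (g x) y"
    by (rule *[OF smooth_map_on_continuous_grad[OF smooth_g]])
  show "(\<lambda>n. grad (h i (xs n)) (ys n)) \<longlonglongrightarrow> grad (h i x) y"
    by (rule *[OF smooth_map_on_continuous_grad[OF smooth_h]])
  show "(\<lambda>n. hessian (g (xs n)) (ys n) *v d) \<longlonglongrightarrow> hessian (g x) y *v d"
    by (rule *[OF smooth_map_on_continuous_hessian[OF smooth_g]])
  show "(\<lambda>n. hessian (h i (xs n)) (ys n) *v d) \<longlonglongrightarrow> hessian (h i x) y *v d"
    by (rule *[OF smooth_map_on_continuous_hessian[OF smooth_h]])
qed

lemma tendsto_hess_lagr:
  assumes "\<And>n. xs n \<in> X" "xs \<longlonglongrightarrow> x" "x \<in> X" "ys \<longlonglongrightarrow> y" "ls \<longlonglongrightarrow> l" "ds \<longlonglongrightarrow> d"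
  shows "(\<lambda>n. hess_lagr g h (xs n) (ys n) (ls n) (ds n)) \<longlonglongrightarrow> hess_lagr g h x y l d"
  unfolding hess_lagr_def
  using tendsto_hessian_mult[OF tendsto_problem(5)[OF assms(1-4)] assms(6)]
    tendsto_hessian_mult[OF tendsto_problem(6)[OF assms(1-4)] assms(6)]
  by (intro tendsto_add tendsto_sum tendsto_scaleR tendsto_vec_nth assms(5))

lemma feasible_limit:
  assumes "\<And>n. xs n \<in> X" "xs \<longlonglongrightarrow> x" "x \<in> X" "ys \<longlonglongrightarrow> y" "\<And>n. ys n \<in> feasible h (xs n)"
  shows "y \<in> feasible h x"
  unfolding feasible_def mem_Collect_eq
proof
  show "h i x y \<le> 0" for i
    by (rule tendsto_upperbound[OF tendsto_problem(2)[OF assms(1-4), of i]]) (use assms(5) in \<open>auto simp: feasible_def\<close>)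
qed

lemma active_independent:
  assumes "x \<in> X" "y \<in> feasible h x"
  shows "inj_on (\<lambda>i. grad (h i x) y) (active h x y)"
    and "independent ((\<lambda>i. grad (h i x) y) ` active h x y)"
  using LICQ[OF assms(1)] assms(2) by (auto simp: LICQ_def)

lemma KKT_pairD:
  assumes "KKT_pair g h x y l"
  shows "grad (g x) y + (\<Sum>i\<in>UNIV. l $ i *\<^sub>R grad (h i x) y) = 0" "y \<in> feasible h x" "l $ i \<ge> 0"
    "l $ i * h i x y = 0" "i \<notin> active h x y \<Longrightarrow> l $ i = 0"
  using assms by (auto simp: KKT_pair_def feasible_def active_def)

lemma KKT_active_pos: "x \<in> X \<Longrightarrow> KKT_pair g h x y l \<Longrightarrow> i \<in> active h x y \<Longrightarrow> l $ i > 0"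
  using SCSC[of x] by (force simp: SCSC_def active_def)

lemma local_minimizer_KKT:
  assumes x: "x \<in> X" and "local_minimizer g h x y"
  obtains l where "KKT_pair g h x y l"
proof -
  obtain e where y: "y \<in> feasible h x" "e > 0" "\<And>z. z \<in> feasible h x \<Longrightarrow> dist z y < e \<Longrightarrow> g x y \<le> g x z"
    using assms(2) by (auto simp: local_minimizer_def)
  have "continuous_on UNIV (grad (g x))"
    using has_derivative_continuous[OF smooth_map_on_has_derivative_grad[OF smooth_g x]]
    by (simp add: continuous_at_imp_continuous_on)
  moreover have "continuous_on UNIV (grad (h i x))" for i
    using has_derivative_continuous[OF smooth_map_on_has_derivative_grad[OF smooth_h x]]
    by (simp add: continuous_at_imp_continuous_on)
  ultimately obtain l :: "real^'k" where "grad (g x) y + (\<Sum>i\<in>UNIV. l $ i *\<^sub>R grad (h i x) y) = 0"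
    "\<And>i. l $ i \<ge> 0" "\<And>i. l $ i * h i x y = 0"
  proof (rule KKT_necessary[OF smooth_map_on_GDERIV[OF smooth_g x] smooth_map_on_GDERIV[OF smooth_h x] _ _ _ y(2)])
    show "h i x y \<le> 0" for i using y(1) by (simp add: feasible_def)
    show "g x y \<le> g x z" if "\<And>i. h i x z \<le> 0" "dist z y < e" for z
      using that y(3) by (simp add: feasible_def)
  qed (use active_independent[OF x y(1)] in \<open>simp_all add: active_def\<close>)
  then have "KKT_pair g h x y l" using y(1) by (simp add: KKT_pair_def feasible_def)
  then show thesis by (rule that)
qed

lemma KKT_unique:
  assumes x: "x \<in> X" and "KKT_pair g h x y l" "KKT_pair g h x y l'"
  shows "l = l'"
proof -
  note K = KKT_pairD[OF assms(2)] KKT_pairD[OF assms(3)]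
  obtain c where c: "c > 0" "\<And>\<mu>::real^'k. (\<And>i. i \<notin> active h x y \<Longrightarrow> \<mu> $ i = 0) \<Longrightarrow>
      c * norm \<mu> \<le> norm (\<Sum>i\<in>UNIV. \<mu> $ i *\<^sub>R grad (h i x) y)"
    by (rule independent_family_bounded_below[OF active_independent[OF x K(2)]]) blast
  have "(\<Sum>i\<in>UNIV. (l - l') $ i *\<^sub>R grad (h i x) y) = 0"
    using add_left_imp_eq[OF trans[OF K(1) K(6)[symmetric]]] by (simp add: scaleR_diff_left sum_subtractf)
  then have "c * norm (l - l') \<le> 0" using c(2)[of "l - l'"] K(5,10) by simp
  then show ?thesis using c(1) by (simp add: mult_le_0_iff)
qed

text \<open>Compactness comes from LICQ at the limit point: a constraint inactive there is inactive
  for late n and has multiplier 0, so the remaining multipliers belong to gradients close to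
  independent ones.\<close>

lemma KKT_limit:
  assumes "\<And>n. xs n \<in> X" "xs \<longlonglongrightarrow> x" "x \<in> X" "ys \<longlonglongrightarrow> y" "\<And>n. KKT_pair g h (xs n) (ys n) (ls n)"
  obtains r l where "strict_mono r" "(\<lambda>n. ls (r n)) \<longlonglongrightarrow> l" "KKT_pair g h x y l"
proof -
  note lim = tendsto_problem[OF assms(1-4)]
  have feas: "y \<in> feasible h x"
    by (rule feasible_limit[OF assms(1-4)]) (use KKT_pairD(2) assms(5) in blast)
  have "eventually (\<lambda>n. ls n $ i = 0) sequentially" if "i \<in> - active h x y" for i
  proof -
    have "h i x y < 0" using that feas by (auto simp: active_def feasible_def less_le)
    from order_tendstoD(2)[OF lim(2) this] show ?thesis
      by (rule eventually_mono) (use KKT_pairD(5)[OF assms(5)] in \<open>auto simp: active_def\<close>)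
  qed
  then have "eventually (\<lambda>n. \<forall>i\<in>- active h x y. ls n $ i = 0) sequentially"
    by (intro eventually_ball_finite) auto
  then have off: "eventually (\<lambda>n. \<forall>i. i \<notin> active h x y \<longrightarrow> ls n $ i = 0) sequentially"
    by (rule eventually_mono) auto
  have "(\<Sum>i\<in>UNIV. ls n $ i *\<^sub>R grad (h i (xs n)) (ys n)) = - grad (g (xs n)) (ys n)" for n
    using KKT_pairD(1)[OF assms(5)] by (metis add_eq_0_iff)
  then have sum: "(\<lambda>n. \<Sum>i\<in>UNIV. ls n $ i *\<^sub>R grad (h i (xs n)) (ys n)) \<longlonglongrightarrow> - grad (g x) y"
    using lim(3) by (simp add: tendsto_minus)
  obtain r l where r: "strict_mono r" "(\<lambda>n. ls (r n)) \<longlonglongrightarrow> l"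
      "(\<Sum>i\<in>UNIV. l $ i *\<^sub>R grad (h i x) y) = - grad (g x) y"
    by (rule multipliers_subsequence[OF active_independent[OF assms(3) feas] lim(4) off sum])
  have li: "(\<lambda>n. ls (r n) $ i) \<longlonglongrightarrow> l $ i" for i using r(2) by (rule tendsto_vec_nth)
  have "KKT_pair g h x y l"
    unfolding KKT_pair_def
  proof (intro conjI allI)
    show "grad (g x) y + (\<Sum>i\<in>UNIV. l $ i *\<^sub>R grad (h i x) y) = 0" by (simp add: r(3))
    fix i
    show "h i x y \<le> 0" using feas by (simp add: feasible_def)
    show "0 \<le> l $ i"
      by (rule tendsto_lowerbound[OF li]) (use KKT_pairD(3)[OF assms(5)] in auto)
    have "(\<lambda>n. h i (xs (r n)) (ys (r n))) \<longlonglongrightarrow> h i x y"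
      using LIMSEQ_subseq_LIMSEQ[OF lim(2) r(1)] by (simp add: o_def)
    from tendsto_mult[OF li[of i] this] have "(\<lambda>n. 0) \<longlonglongrightarrow> l $ i * h i x y"
      by (simp only: KKT_pairD(4)[OF assms(5)])
    then show "l $ i * h i x y = 0" by (simp only: LIMSEQ_const_iff)
  qed
  then show thesis using that r by blast
qed

lemma lagrangian_derivatives:
  assumes x: "x \<in> X"
  shows "GDERIV (\<lambda>z. lagrangian g h x z l) y :> grad (g x) y + (\<Sum>i\<in>UNIV. l $ i *\<^sub>R grad (h i x) y)"
    and "((\<lambda>y. grad (g x) y + (\<Sum>i\<in>UNIV. l $ i *\<^sub>R grad (h i x) y)) has_derivative hess_lagr g h x y l) (at y)"
proof -
  have "((\<lambda>z. lagrangian g h x z l) has_derivative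
      (\<lambda>v. v \<bullet> grad (g x) y + (\<Sum>i\<in>UNIV. l $ i * (v \<bullet> grad (h i x) y)))) (at y)"
    unfolding lagrangian_def
    using smooth_map_on_GDERIV[OF smooth_g x] smooth_map_on_GDERIV[OF smooth_h x]
    by (intro has_derivative_add has_derivative_sum has_derivative_mult_right) (auto simp: gderiv_def)
  then show "GDERIV (\<lambda>z. lagrangian g h x z l) y :> grad (g x) y + (\<Sum>i\<in>UNIV. l $ i *\<^sub>R grad (h i x) y)"
    by (simp add: gderiv_def inner_add_right inner_sum_right)
  show "((\<lambda>y. grad (g x) y + (\<Sum>i\<in>UNIV. l $ i *\<^sub>R grad (h i x) y)) has_derivative hess_lagr g h x y l) (at y)"
    unfolding hess_lagr_def[abs_def]
    by (intro has_derivative_add has_derivative_sum has_derivative_scaleR_right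
        smooth_map_on_has_derivative_grad[OF smooth_g x] smooth_map_on_has_derivative_grad[OF smooth_h x])
qed

lemma hessian_lagrangian:
  assumes x: "x \<in> X"
  shows "hessian (\<lambda>z. lagrangian g h x z l) y *v d = hess_lagr g h x y l d"
proof -
  have "grad (\<lambda>z. lagrangian g h x z l) = (\<lambda>y. grad (g x) y + (\<Sum>i\<in>UNIV. l $ i *\<^sub>R grad (h i x) y))"
    using grad_eqI[OF lagrangian_derivatives(1)[OF x]] by blast
  then have der: "(grad (\<lambda>z. lagrangian g h x z l) has_derivative hess_lagr g h x y l) (at y)"
    using lagrangian_derivatives(2)[OF x] by simp
  then have "(grad (\<lambda>z. lagrangian g h x z l) has_derivative (*v) (hessian (\<lambda>z. lagrangian g h x z l) y)) (at y)"
    unfolding hessian_def using jacobian_works differentiableI by blast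
  from fun_cong[OF has_derivative_unique[OF this der]] show ?thesis .
qed

lemma uniform_second_order:
  obtains \<sigma> where "\<sigma> > 0" "\<And>x y l. x \<in> X \<Longrightarrow> local_minimizer g h x y \<Longrightarrow> KKT_pair g h x y l \<Longrightarrow>
     second_order g h \<sigma> x y l"
proof -
  obtain \<sigma> where \<sigma>: "\<sigma> > 0" "\<forall>x\<in>X. \<forall>y l. local_minimizer g h x y \<longrightarrow> KKT_pair g h x y l \<longrightarrow>
     (\<forall>d\<in>critical_cone h x y l. \<sigma> * (norm d)\<^sup>2 \<le> d \<bullet> (hessian (\<lambda>z. lagrangian g h x z l) y *v d))"
    using SOSC unfolding uniform_SOSC_def by blast
  have "second_order g h \<sigma> x y l" if "x \<in> X" "local_minimizer g h x y" "KKT_pair g h x y l" for x y l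
    unfolding second_order_def
  proof (intro allI impI)
    fix d assume "\<forall>i\<in>active h x y. grad (h i x) y \<bullet> d = 0"
    then have "d \<in> critical_cone h x y l" by (simp add: critical_cone_def)
    then show "\<sigma> * (norm d)\<^sup>2 \<le> d \<bullet> hess_lagr g h x y l d"
      using \<sigma>(2) that by (simp add: hessian_lagrangian)
  qed
  then show thesis using that \<sigma>(1) by blast
qed

text \<open>A constraint active at the limit has a positive multiplier by SCSC; late multipliers are
  then positive too, and complementarity forces activity. Inactivity persists by continuity.\<close>

lemma active_eventually_constant:
  assumes "\<And>n. xs n \<in> X" "xs \<longlonglongrightarrow> x" "x \<in> X" "ys \<longlonglongrightarrow> y" "ls \<longlonglongrightarrow> l"
    and "\<And>n. KKT_pair g h (xs n) (ys n) (ls n)" "KKT_pair g h x y l"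
  shows "eventually (\<lambda>n. active h (xs n) (ys n) = active h x y) sequentially"
proof -
  have "eventually (\<lambda>n. i \<in> active h (xs n) (ys n) \<longleftrightarrow> i \<in> active h x y) sequentially" for i
  proof (cases "i \<in> active h x y")
    case True
    then have "0 < l $ i" by (rule KKT_active_pos[OF assms(3,7)])
    from order_tendstoD(1)[OF tendsto_vec_nth[OF assms(5)] this] show ?thesis
      by (rule eventually_mono) (use True KKT_pairD(5)[OF assms(6)] in force)
  next
    case False
    then have "h i x y < 0" using KKT_pairD(2)[OF assms(7)] by (auto simp: active_def feasible_def less_le)
    from order_tendstoD(2)[OF tendsto_problem(2)[OF assms(1-4)] this] show ?thesis
      by (rule eventually_mono) (use False in \<open>auto simp: active_def\<close>)
  qed
  then have "eventually (\<lambda>n. \<forall>i\<in>UNIV. i \<in> active h (xs n) (ys n) \<longleftrightarrow> i \<in> active h x y) sequentially"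
    by (intro eventually_ball_finite) auto
  then show ?thesis by (rule eventually_mono) auto
qed

text \<open>A direction \<open>d\<close> tangent at the limit need not be tangent at
  \<open>(xs n, ys n)\<close>. It is replaced by its component \<open>q n\<close> orthogonal to the
  active gradients there. Uniform independence of these gradients gives
  \<open>q \<longlonglongrightarrow> d\<close>, and the inequality with fixed \<sigma> passes to the
  limit.\<close>

lemma second_order_limit:
  assumes "\<And>n. xs n \<in> X" "xs \<longlonglongrightarrow> x" "x \<in> X" "ys \<longlonglongrightarrow> y" "ls \<longlonglongrightarrow> l"
    and "\<And>n. KKT_pair g h (xs n) (ys n) (ls n)" "KKT_pair g h x y l"
    and so: "\<And>n. second_order g h \<sigma> (xs n) (ys n) (ls n)"
  shows "second_order g h \<sigma> x y l"
  unfolding second_order_def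
proof (intro allI impI)
  fix d assume d: "\<forall>i\<in>active h x y. grad (h i x) y \<bullet> d = 0"
  define J where "J = active h x y"
  define V where "V n i = grad (h i (xs n)) (ys n)" for n i
  have V: "(\<lambda>n. V n i) \<longlonglongrightarrow> grad (h i x) y" for i
    unfolding V_def by (rule tendsto_problem(4)[OF assms(1-4)])
  have J: "eventually (\<lambda>n. active h (xs n) (ys n) = J) sequentially"
    unfolding J_def by (rule active_eventually_constant[OF assms(1-7)])
  obtain c where "c > 0" and c: "eventually (\<lambda>n. \<forall>\<mu>::real^'k. (\<forall>i. i \<notin> J \<longrightarrow> \<mu> $ i = 0) \<longrightarrow>
       c * norm \<mu> \<le> norm (\<Sum>i\<in>UNIV. \<mu> $ i *\<^sub>R V n i)) sequentially"
    unfolding J_def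
    by (rule independent_family_perturb[OF active_independent[OF assms(3) KKT_pairD(2)[OF assms(7)]] V])
  \<comment> \<open>The multipliers supported on \<open>J\<close>; \<open>T n\<close> maps this
    space onto the span of the gradients \<open>V n i\<close> with i in \<open>J\<close>.\<close>
  define K where "K = {\<mu>::real^'k. \<forall>i. i \<notin> J \<longrightarrow> \<mu> $ i = 0}"
  define T where "T n \<mu> = (\<Sum>i\<in>UNIV. \<mu> $ i *\<^sub>R V n i)" for n and \<mu> :: "real^'k"
  have T: "linear (T n)" for n
    by (auto intro!: linearI simp: T_def scaleR_add_left sum.distrib scaleR_sum_right)
  have "subspace K" by (auto simp: K_def subspace_def)
  then have sub: "subspace (T n ` K)" for n by (rule linear_subspace_image[OF T])
  have "\<exists>\<mu> q. \<mu> \<in> K \<and> d = T n \<mu> + q \<and> (\<forall>w\<in>K. q \<bullet> T n w = 0)" for n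
  proof -
    obtain p q where "p \<in> span (T n ` K)" "\<And>w. w \<in> span (T n ` K) \<Longrightarrow> orthogonal q w" "d = p + q"
      using orthogonal_subspace_decomp_exists[of "T n ` K" d] by blast
    moreover have span: "span (T n ` K) = T n ` K" using sub[of n] by (simp add: span_eq_iff)
    ultimately obtain \<mu> where "\<mu> \<in> K" "p = T n \<mu>" by auto
    then show ?thesis
      using \<open>d = p + q\<close> \<open>\<And>w. w \<in> span (T n ` K) \<Longrightarrow> orthogonal q w\<close> unfolding span orthogonal_def by blast
  qed
  then obtain \<mu> q where \<mu>: "\<And>n. \<mu> n \<in> K" "\<And>n. d = T n (\<mu> n) + q n" "\<And>n w. w \<in> K \<Longrightarrow> q n \<bullet> T n w = 0"
    by metis
  have qV: "q n \<bullet> V n i = 0" if "i \<in> J" for n i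
  proof -
    have "axis i 1 \<in> K" using that by (auto simp: K_def axis_def)
    moreover have "T n (axis i 1) = (\<Sum>j\<in>UNIV. if j = i then V n j else 0)"
      unfolding T_def by (intro sum.cong) (auto simp: axis_def)
    ultimately show ?thesis using \<mu>(3)[of "axis i 1" n] by simp
  qed
  have "(\<lambda>n. (1 / c) * (\<Sum>i\<in>J. \<bar>V n i \<bullet> d\<bar>)) \<longlonglongrightarrow> (1 / c) * (\<Sum>i\<in>J. \<bar>grad (h i x) y \<bullet> d\<bar>)"
    by (intro tendsto_intros V)
  then have lim0: "(\<lambda>n. (1 / c) * (\<Sum>i\<in>J. \<bar>V n i \<bullet> d\<bar>)) \<longlonglongrightarrow> 0" using d by (simp add: J_def)
  have "eventually (\<lambda>n. norm (T n (\<mu> n)) \<le> (1 / c) * (\<Sum>i\<in>J. \<bar>V n i \<bullet> d\<bar>)) sequentially"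
    using c
  proof eventually_elim
    case (elim n)
    \<comment> \<open>With p for \<open>?p\<close>: |p|^2 = p \<bullet> d, which is the sum of the
      \<open>\<mu> n $ i * (V n i \<bullet> d)\<close> over \<open>J\<close>, hence at most |\<mu>
      n| ?S <= |p| ?S / c. Thus |p| <= ?S / c, and \<open>?S\<close> tends to 0 because
      \<open>d\<close> is tangent at the limit.\<close>
    let ?S = "\<Sum>i\<in>J. \<bar>V n i \<bullet> d\<bar>" and ?p = "T n (\<mu> n)"
    have c\<mu>: "c * norm (\<mu> n) \<le> norm ?p" using elim \<mu>(1)[of n] by (simp add: K_def T_def)
    have "(norm ?p)\<^sup>2 = ?p \<bullet> (?p + q n)"
      using \<mu>(3)[OF \<mu>(1), of n n] by (simp add: inner_add_right power2_norm_eq_inner inner_commute)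
    also have "\<dots> = (\<Sum>i\<in>UNIV. \<mu> n $ i * (V n i \<bullet> d))"
      unfolding \<mu>(2)[of n, symmetric] by (simp add: T_def inner_sum_left)
    also have "\<dots> = (\<Sum>i\<in>J. \<mu> n $ i * (V n i \<bullet> d))"
      by (rule sum.mono_neutral_right) (use \<mu>(1)[of n] in \<open>auto simp: K_def\<close>)
    also have "\<dots> \<le> (\<Sum>i\<in>J. norm (\<mu> n) * \<bar>V n i \<bullet> d\<bar>)"
    proof (rule sum_mono)
      fix i
      have "\<mu> n $ i * (V n i \<bullet> d) \<le> \<bar>\<mu> n $ i\<bar> * \<bar>V n i \<bullet> d\<bar>" by (metis abs_ge_self abs_mult)
      also have "\<dots> \<le> norm (\<mu> n) * \<bar>V n i \<bullet> d\<bar>"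
        by (intro mult_right_mono component_le_norm_cart) auto
      finally show "\<mu> n $ i * (V n i \<bullet> d) \<le> norm (\<mu> n) * \<bar>V n i \<bullet> d\<bar>" .
    qed
    finally have "(norm ?p)\<^sup>2 \<le> norm (\<mu> n) * ?S" by (simp add: sum_distrib_left)
    then have "c * (norm ?p)\<^sup>2 \<le> (c * norm (\<mu> n)) * ?S" using \<open>c > 0\<close> by (simp add: mult.assoc)
    also have "\<dots> \<le> norm ?p * ?S" by (intro mult_right_mono c\<mu> sum_nonneg) auto
    finally have "norm ?p * (c * norm ?p) \<le> norm ?p * ?S" by (simp add: power2_eq_square mult_ac)
    moreover have "0 \<le> ?S" by (intro sum_nonneg) auto
    ultimately have "c * norm ?p \<le> ?S" by (cases "norm ?p = 0") auto
    then show ?case using \<open>c > 0\<close> by (simp add: field_simps)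
  qed
  then have "(\<lambda>n. T n (\<mu> n)) \<longlonglongrightarrow> 0" using lim0 by (rule Lim_null_comparison)
  then have "(\<lambda>n. d - T n (\<mu> n)) \<longlonglongrightarrow> d - 0" by (intro tendsto_intros)
  moreover have "d - T n (\<mu> n) = q n" for n using \<mu>(2)[of n] by (simp add: algebra_simps)
  ultimately have q: "q \<longlonglongrightarrow> d" by simp
  have "(\<lambda>n. q n \<bullet> hess_lagr g h (xs n) (ys n) (ls n) (q n)) \<longlonglongrightarrow> d \<bullet> hess_lagr g h x y l d"
    by (intro tendsto_inner q tendsto_hess_lagr assms)
  moreover have "(\<lambda>n. \<sigma> * (norm (q n))\<^sup>2) \<longlonglongrightarrow> \<sigma> * (norm d)\<^sup>2"
    by (intro tendsto_intros q)
  moreover have "eventually (\<lambda>n. \<sigma> * (norm (q n))\<^sup>2 \<le> q n \<bullet> hess_lagr g h (xs n) (ys n) (ls n) (q n)) sequentially"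
    using J
  proof eventually_elim
    case (elim n)
    then show ?case using so[of n] qV by (simp add: second_order_def V_def inner_commute)
  qed
  ultimately show "\<sigma> * (norm d)\<^sup>2 \<le> d \<bullet> hess_lagr g h x y l d"
    by (rule tendsto_le[OF trivial_limit_sequentially])
qed

text \<open>Along feasible points \<open>z\<^sub>n \<longlongrightarrow> y\<close> with smaller objective, the growth of the Lagrangian forces
  \<open>h\<^sub>i(z\<^sub>n) = O(|z\<^sub>n - y|\<^sup>2)\<close> for active \<open>i\<close>, since these have positive multipliers. Hence the limiting
  direction is tangent to all active constraints.\<close>

lemma second_order_sufficient:
  assumes x: "x \<in> X" and kkt: "KKT_pair g h x y l" and so: "second_order g h \<sigma> x y l" and "\<sigma> > 0"
  shows "local_minimizer g h x y"
proof (rule ccontr)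
  assume not: "\<not> local_minimizer g h x y"
  note K = KKT_pairD[OF kkt]
  have "\<exists>z. z \<in> feasible h x \<and> dist z y < 1 / real (Suc n) \<and> g x z < g x y" for n
    using not K(2) unfolding local_minimizer_def by (meson not_le of_nat_0_less_iff zero_less_Suc zero_less_divide_1_iff)
  then obtain z0 where z0: "\<And>n. z0 n \<in> feasible h x" "\<And>n. dist (z0 n) y < 1 / real (Suc n)"
      "\<And>n. g x (z0 n) < g x y" by metis
  have z0lim: "z0 \<longlonglongrightarrow> y" using z0(2) by (rule LIMSEQ_inverse_Suc)
  have z0y: "z0 n \<noteq> y" for n using z0(3)[of n] by auto
  then have "(z0 n - y) /\<^sub>R norm (z0 n - y) \<in> sphere 0 1" for n by simp
  from compact_sphere[unfolded compact_def, rule_format, of "\<lambda>n. (z0 n - y) /\<^sub>R norm (z0 n - y)", OF this]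
  obtain r d where r: "strict_mono r" and d: "d \<in> sphere 0 1"
    "((\<lambda>n. (z0 n - y) /\<^sub>R norm (z0 n - y)) \<circ> r) \<longlonglongrightarrow> d"
    by blast
  define z where "z n = z0 (r n)" for n
  have z: "z n \<in> feasible h x" "g x (z n) < g x y" "z n \<noteq> y" for n
    using z0(1,3) z0y by (simp_all add: z_def)
  have zlim: "z \<longlonglongrightarrow> y" using LIMSEQ_subseq_LIMSEQ[OF z0lim r] by (simp add: z_def[abs_def] o_def)
  define dn where "dn n = (z n - y) /\<^sub>R norm (z n - y)" for n
  have dlim: "dn \<longlonglongrightarrow> d" using d(2) by (simp add: dn_def[abs_def] z_def o_def)
  define t where "t n = norm (z n - y)" for n
  have t: "t n > 0" "z n - y = t n *\<^sub>R dn n" "norm (dn n) = 1" for n using z(3) by (auto simp: t_def dn_def)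
  have tlim: "t \<longlonglongrightarrow> 0" unfolding t_def[abs_def] using zlim LIM_zero tendsto_norm_zero by blast
  define H where "H = hess_lagr g h x y l"
  have linH: "linear H" using lagrangian_derivatives(2)[OF x] has_derivative_linear H_def by blast
  \<comment> \<open>By complementarity the Lagrangian equals g at \<open>y\<close>, and at feasible
    points it is at most g; hence the points \<open>z n\<close> lower the Lagrangian too.\<close>
  have Ly: "lagrangian g h x y l = g x y" by (simp add: lagrangian_def K(4))
  have lh: "l $ i * h i x (z n) \<le> 0" for i n
    using K(3)[of i] z(1)[of n] by (auto simp: feasible_def mult_nonneg_nonpos)
  have growth: "eventually (\<lambda>n. \<exists>s\<in>{0<..1}. s * (t n)\<^sup>2 * (dn n \<bullet> H (dn n) - e) \<le>
      lagrangian g h x (z n) l - g x y) sequentially" if e: "e > 0" for e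
  proof -
    obtain \<delta> where \<delta>: "\<delta> > 0" "\<And>w. norm (w - y) < \<delta> \<Longrightarrow> \<exists>s\<in>{0<..1}.
        s * ((w - y) \<bullet> H (w - y) - e * (norm (w - y))\<^sup>2) \<le> lagrangian g h x w l - lagrangian g h x y l"
      using second_order_growth[where L = "\<lambda>z. lagrangian g h x z l" and y = y and
            L' = "\<lambda>y. grad (g x) y + (\<Sum>i\<in>UNIV. l $ i *\<^sub>R grad (h i x) y)",
          OF lagrangian_derivatives(1)[OF x] K(1) lagrangian_derivatives(2)[OF x] e]
      unfolding H_def by blast
    have "eventually (\<lambda>n. t n < \<delta>) sequentially" by (rule order_tendstoD(2)[OF tlim \<delta>(1)])
    then show ?thesis
    proof eventually_elim
      case (elim n)
      have eq: "(z n - y) \<bullet> H (z n - y) - e * (norm (z n - y))\<^sup>2 = (t n)\<^sup>2 * (dn n \<bullet> H (dn n) - e)"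
        unfolding t(2) using t(1,3)[of n] by (simp add: linear_cmul[OF linH] power2_eq_square algebra_simps)
      show ?case using \<delta>(2)[of "z n"] elim unfolding eq Ly by (simp add: t_def mult.assoc)
    qed
  qed
  have Hlim: "(\<lambda>n. dn n \<bullet> H (dn n)) \<longlonglongrightarrow> d \<bullet> H d"
    using linH by (intro tendsto_inner dlim bounded_linear.tendsto[OF _ dlim]) (simp add: linear_conv_bounded_linear)
  have "d \<bullet> H d \<le> e" if "e > 0" for e
  proof (rule tendsto_upperbound[OF Hlim])
    show "eventually (\<lambda>n. dn n \<bullet> H (dn n) \<le> e) sequentially"
      using growth[OF that]
    proof eventually_elim
      case (elim n)
      then obtain s where s: "s > 0" "s * (t n)\<^sup>2 * (dn n \<bullet> H (dn n) - e) \<le> lagrangian g h x (z n) l - g x y"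
        by auto
      have "lagrangian g h x (z n) l - g x y < 0"
        using z(2)[of n] sum_nonpos[of UNIV "\<lambda>i. l $ i * h i x (z n)"] lh by (simp add: lagrangian_def)
      then have "s * (t n)\<^sup>2 * (dn n \<bullet> H (dn n) - e) < 0" using s(2) by simp
      moreover have "s * (t n)\<^sup>2 > 0" using s(1) t(1)[of n] by simp
      ultimately have "dn n \<bullet> H (dn n) - e < 0" by (metis mult_less_0_iff not_less_iff_gr_or_eq)
      then show ?case by simp
    qed
  qed simp
  then have "d \<bullet> H d \<le> 0" by (meson dense_ge)
  moreover have "grad (h i x) y \<bullet> d = 0" if i: "i \<in> active h x y" for i
  proof -
    have li: "l $ i > 0" by (rule KKT_active_pos[OF x kkt i])
    have hy: "h i x y = 0" using i by (simp add: active_def)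
    have quot: "(\<lambda>n. (h i x (z n) - h i x y) / norm (z n - y)) \<longlonglongrightarrow> d \<bullet> grad (h i x) y"
      by (rule directional_quotient_tendsto[OF smooth_map_on_GDERIV[OF smooth_h x] zlim z(3)])
        (use dlim in \<open>simp add: dn_def[abs_def]\<close>)
    then have quot: "(\<lambda>n. l $ i * (h i x (z n) / t n)) \<longlonglongrightarrow> l $ i * (d \<bullet> grad (h i x) y)"
      by (intro tendsto_intros) (simp add: hy t_def)
    have "l $ i * (d \<bullet> grad (h i x) y) \<le> 0"
      by (rule tendsto_upperbound[OF quot]) (use lh t(1) in \<open>auto simp: divide_nonpos_pos\<close>)
    \<comment> \<open>The i-th term can be isolated because all \<open>l $ j * h j x (z n)\<close>
      are nonpositive, so a lower bound for their sum bounds each of them. Any constant would do in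
      place of e = 1: a bound of order t^2 is still of order t after division by t.\<close>
    moreover have "0 \<le> l $ i * (d \<bullet> grad (h i x) y)"
    proof (rule tendsto_le[OF trivial_limit_sequentially quot])
      have "(\<lambda>n. - t n * \<bar>dn n \<bullet> H (dn n) - 1\<bar>) \<longlonglongrightarrow> - 0 * \<bar>d \<bullet> H d - 1\<bar>"
        by (intro tendsto_intros tlim Hlim)
      then show "(\<lambda>n. - t n * \<bar>dn n \<bullet> H (dn n) - 1\<bar>) \<longlonglongrightarrow> 0" by simp
      show "eventually (\<lambda>n. - t n * \<bar>dn n \<bullet> H (dn n) - 1\<bar> \<le> l $ i * (h i x (z n) / t n)) sequentially"
        using growth[OF zero_less_one]
      proof eventually_elim
        case (elim n)
        let ?q = "dn n \<bullet> H (dn n) - 1"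
        from elim obtain s where s: "s > 0" "s \<le> 1" "s * (t n)\<^sup>2 * ?q \<le> lagrangian g h x (z n) l - g x y"
          by auto
        have "s * ((t n)\<^sup>2 * \<bar>?q\<bar>) \<le> 1 * ((t n)\<^sup>2 * \<bar>?q\<bar>)" using s by (intro mult_right_mono) auto
        then have "- ((t n)\<^sup>2 * \<bar>?q\<bar>) \<le> s * ((t n)\<^sup>2 * - \<bar>?q\<bar>)" by simp
        also have "\<dots> \<le> s * ((t n)\<^sup>2 * ?q)" using s by (intro mult_left_mono) auto
        also have "\<dots> < (\<Sum>j\<in>UNIV. l $ j * h j x (z n))"
          using s(3) z(2)[of n] by (simp add: lagrangian_def mult.assoc)
        also have "\<dots> \<le> l $ i * h i x (z n)"
          using sum_nonpos[of "UNIV - {i}" "\<lambda>j. l $ j * h j x (z n)"] lh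
          by (simp add: sum.remove[of UNIV i])
        finally have "(- t n * \<bar>?q\<bar>) * t n \<le> l $ i * h i x (z n)" by (simp add: power2_eq_square mult_ac)
        then show ?case using t(1)[of n] by (simp add: pos_le_divide_eq)
      qed
    qed
    ultimately show ?thesis using li by (simp add: inner_commute)
  qed
  then have "\<sigma> * (norm d)\<^sup>2 \<le> d \<bullet> H d" using so by (simp add: second_order_def H_def)
  ultimately show False using d(1) \<open>\<sigma> > 0\<close> by simp
qed

text \<open>Minimality alone does not pass to limits, since the radius of minimality may shrink to
  0. The KKT conditions do pass along a subsequence, and so does the second-order inequality, as
  \<sigma> is common to all x; together they imply minimality of the limit.\<close>

lemma local_minimizer_limit:
  assumes "\<And>n. xs n \<in> X" "xs \<longlonglongrightarrow> x" "x \<in> X" "ys \<longlonglongrightarrow> y"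
    and "\<And>n. local_minimizer g h (xs n) (ys n)"
  shows "local_minimizer g h x y"
proof -
  have "\<exists>l. KKT_pair g h (xs n) (ys n) l" for n
    using local_minimizer_KKT[OF assms(1,5)] by blast
  then obtain ls where ls: "\<And>n. KKT_pair g h (xs n) (ys n) (ls n)" by metis
  obtain r l where r: "strict_mono r" "(\<lambda>n. ls (r n)) \<longlonglongrightarrow> l" "KKT_pair g h x y l"
    by (rule KKT_limit[OF assms(1-4) ls])
  obtain \<sigma> where \<sigma>: "\<sigma> > 0" "\<And>x y l. x \<in> X \<Longrightarrow> local_minimizer g h x y \<Longrightarrow> KKT_pair g h x y l \<Longrightarrow>
     second_order g h \<sigma> x y l" by (rule uniform_second_order) blast
  have sub: "(\<lambda>n. xs (r n)) \<longlonglongrightarrow> x" "(\<lambda>n. ys (r n)) \<longlonglongrightarrow> y"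
    using LIMSEQ_subseq_LIMSEQ[OF assms(2) r(1)] LIMSEQ_subseq_LIMSEQ[OF assms(4) r(1)] by (auto simp: o_def)
  have "second_order g h \<sigma> x y l"
    by (rule second_order_limit[OF assms(1) sub(1) assms(3) sub(2) r(2) ls r(3) \<sigma>(2)[OF assms(1,5) ls]])
  then show ?thesis by (rule second_order_sufficient[OF assms(3) r(3) _ \<sigma>(1)])
qed

end

section \<open>Smooth local branches\<close>

context lower_level_problem
begin

text \<open>The complementarity equations \<open>l\<^sub>i h\<^sub>i = 0\<close> are kept for all \<open>i\<close>: by strict complementarity the
  resulting square system is nonsingular without singling out the active constraints.\<close>

lemma KKT_smooth_branch:
  assumes x0: "x0 \<in> X" and kkt: "KKT_pair g h x0 y0 l0"
    and so: "second_order g h \<sigma> x0 y0 l0" and "\<sigma> > 0"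
  obtains S T s where "x0 \<in> S" "open T" "(y0, l0) \<in> T" "smooth_on_open s S" "s x0 = (y0, l0)"
    "\<And>x y l. x \<in> S \<Longrightarrow> x \<in> X \<Longrightarrow> (y, l) \<in> T \<Longrightarrow> KKT_pair g h x y l \<Longrightarrow> (y, l) = s x"
    "\<And>x y l. x \<in> S \<Longrightarrow> x \<in> X \<Longrightarrow> s x = (y, l) \<Longrightarrow>
       grad (g x) y + (\<Sum>i\<in>UNIV. l $ i *\<^sub>R grad (h i x) y) = 0 \<and> (\<forall>i. l $ i * h i x y = 0)"
proof -
  note K = KKT_pairD[OF kkt]
  obtain G Ug where G: "smooth_extension g G Ug X" "(x0, y0) \<in> Ug"
    by (rule smooth_map_on_extension[OF smooth_g x0])
  have "\<exists>H U. smooth_extension (h i) H U X \<and> (x0, y0) \<in> U" for i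
    using smooth_map_on_extension[OF smooth_h[of i] x0] by metis
  then obtain H Uh where H: "\<And>i. smooth_extension (h i) (H i) (Uh i) X" "\<And>i. (x0, y0) \<in> Uh i"
    by metis
  \<comment> \<open>One domain for all extensions at once; finiteness of the index type keeps it
    open.\<close>
  define U where "U = Ug \<inter> (\<Inter>i. Uh i)"
  have "open Ug" "\<And>i. open (Uh i)"
    using smooth_extension.smooth[OF G(1)] smooth_extension.smooth[OF H(1)] by (auto simp: smooth_on_open_def)
  then have "open U" unfolding U_def by (intro open_Int open_INT) auto
  have U0: "(x0, y0) \<in> U" using G(2) H(2) by (simp add: U_def)
  have smG: "smooth_on_open (partial_grad G) U"
    by (rule smooth_on_open_subset[OF smooth_on_open_partial_grad[OF smooth_extension.smooth[OF G(1)]] \<open>open U\<close>])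
      (simp add: U_def)
  have smH: "smooth_on_open (H i) U" "smooth_on_open (partial_grad (H i)) U" for i
    by (rule smooth_on_open_subset[OF smooth_extension.smooth[OF H(1)] \<open>open U\<close>], use U_def in blast)
      (rule smooth_on_open_subset[OF smooth_on_open_partial_grad[OF smooth_extension.smooth[OF H(1)]] \<open>open U\<close>],
        use U_def in blast)
  have gradG: "partial_grad G (x, y) = grad (g x) y" if "x \<in> X" "(x, y) \<in> U" for x y
    using smooth_extension.grad_eq[OF G(1) that(1)] that(2) by (simp add: U_def)
  have gradH: "partial_grad (H i) (x, y) = grad (h i x) y" "H i (x, y) = h i x y"
    if "x \<in> X" "(x, y) \<in> U" for i x y
    using smooth_extension.grad_eq[OF H(1) that(1)] smooth_extension.eq[OF H(1) that(1)] that(2)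
    by (auto simp: U_def)

  define \<pi> where "\<pi> p = (fst p, fst (snd p))" for p :: "(real^'n) \<times> (real^'m) \<times> (real^'k)"
  have bl\<pi>: "bounded_linear \<pi>"
    unfolding \<pi>_def[abs_def]
    by (intro bounded_linear_Pair bounded_linear_fst bounded_linear_fst_comp bounded_linear_snd)
  have bl_l: "bounded_linear (\<lambda>p::(real^'n) \<times> (real^'m) \<times> (real^'k). snd (snd p) $ i)" for i
    by (rule bounded_linear_compose[OF bounded_linear_vec_nth bounded_linear_snd_comp[OF bounded_linear_snd]])
  define V where "V = \<pi> -` U"
  have "open V" unfolding V_def
    by (rule open_vimage[OF \<open>open U\<close>]) (rule linear_continuous_on[OF bl\<pi>])
  define F where "F p = (partial_grad G (\<pi> p) + (\<Sum>i\<in>UNIV. (snd (snd p) $ i) *\<^sub>R partial_grad (H i) (\<pi> p)),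
      \<Sum>i\<in>UNIV. (snd (snd p) $ i * H i (\<pi> p)) *\<^sub>R axis i (1::real))" for p
  have smF: "smooth_on_open F V"
    unfolding smooth_on_open_def
  proof (intro conjI allI)
    fix r
    have comp: "Ck_on r (\<lambda>p. f (\<pi> p)) V" if "smooth_on_open f U" for f :: "_ \<Rightarrow> 'c::euclidean_space"
      by (rule Ck_on_compose[OF \<open>open V\<close> \<open>open U\<close> _ Ck_on_bounded_linear[OF \<open>open V\<close> bl\<pi>]])
        (use that in \<open>auto simp: V_def smooth_on_open_def\<close>)
    note cl = Ck_on_bounded_linear[OF \<open>open V\<close> bl_l]
    have 1: "Ck_on r (\<lambda>p. (snd (snd p) $ i) *\<^sub>R partial_grad (H i) (\<pi> p)) V" for i
      by (rule Ck_on_bilinear[OF \<open>open V\<close> bounded_bilinear_scaleR cl comp[OF smH(2)]])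
    have 2: "Ck_on r (\<lambda>p. (snd (snd p) $ i * H i (\<pi> p)) *\<^sub>R axis i (1::real)) V" for i
      by (rule Ck_on_linear_compose[OF \<open>open V\<close> bounded_linear_scaleR_left
            Ck_on_bilinear[OF \<open>open V\<close> bounded_bilinear_mult cl comp[OF smH(1)]]])
    show "Ck_on r F V"
      unfolding F_def[abs_def]
      by (rule Ck_on_Pair[OF \<open>open V\<close> Ck_on_add[OF \<open>open V\<close> comp[OF smG]
            Ck_on_sum[OF \<open>open V\<close> finite_class.finite_UNIV 1]]
            Ck_on_sum[OF \<open>open V\<close> finite_class.finite_UNIV 2]])
  qed (rule \<open>open V\<close>)
  have F: "F (x, y, l) = (grad (g x) y + (\<Sum>i\<in>UNIV. l $ i *\<^sub>R grad (h i x) y),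
      \<Sum>i\<in>UNIV. (l $ i * h i x y) *\<^sub>R axis i 1)" if "x \<in> X" "(x, y, l) \<in> V" for x y l
    using that by (simp add: F_def \<pi>_def V_def gradG gradH)
  have sum_axis: "(\<Sum>i\<in>UNIV. a i *\<^sub>R axis i (1::real)) = 0 \<longleftrightarrow> (\<forall>i. a i = 0)" for a :: "'k \<Rightarrow> real"
  proof -
    have "(\<Sum>i\<in>UNIV. a i *\<^sub>R axis i (1::real)) = (\<chi> i. a i)"
      by (simp add: vec_eq_iff axis_def if_distrib cong: if_cong)
    then show ?thesis by (simp add: vec_eq_iff)
  qed
  have V0: "(x0, y0, l0) \<in> V" using U0 by (simp add: V_def \<pi>_def)
  have F0: "F (x0, y0, l0) = 0"
    using F[OF x0 V0] K(1) by (simp add: K(4) zero_prod_def)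
  have inj: "w = 0" if "frechet_derivative F (at (x0, y0, l0)) (0, w) = 0" for w
  proof -
    obtain d e where w: "w = (d, e)" by (cases w)
    define F' where "F' v = (hessian (g x0) y0 *v fst v + (\<Sum>i\<in>UNIV. l0 $ i *\<^sub>R (hessian (h i x0) y0 *v fst v) +
        snd v $ i *\<^sub>R grad (h i x0) y0),
      \<Sum>i\<in>UNIV. (l0 $ i * (fst v \<bullet> grad (h i x0) y0) + snd v $ i * h i x0 y0) *\<^sub>R axis i (1::real))"
      for v :: "(real^'m) \<times> (real^'k)"
    have fst': "((\<lambda>v. f (fst v)) has_derivative (\<lambda>v. f' (fst v))) (at (y0, l0))"
      if "(f has_derivative f') (at y0)" for f :: "_ \<Rightarrow> 'c::real_normed_vector" and f'
      using has_derivative_compose[OF has_derivative_fst[OF has_derivative_ident]] that by fastforce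
    have snd': "((\<lambda>v. snd v $ i) has_derivative (\<lambda>v. snd v $ i)) (at (y0, l0))" for i :: 'k
      by (rule bounded_linear_imp_has_derivative)
        (rule bounded_linear_compose[OF bounded_linear_vec_nth bounded_linear_snd])
    note dg = fst'[OF smooth_map_on_has_derivative_grad[OF smooth_g x0]]
    note dh = fst'[OF smooth_map_on_has_derivative_grad[OF smooth_h x0]]
    note dh0 = fst'[OF smooth_map_on_GDERIV[OF smooth_h x0, unfolded gderiv_def]]
    have "((\<lambda>v. (grad (g x0) (fst v) + (\<Sum>i\<in>UNIV. snd v $ i *\<^sub>R grad (h i x0) (fst v)),
        \<Sum>i\<in>UNIV. (snd v $ i * h i x0 (fst v)) *\<^sub>R axis i 1)) has_derivative F') (at (y0, l0))"
      unfolding F'_def[abs_def]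
      using has_derivative_scaleR[OF snd' dh] has_derivative_mult[OF snd' dh0]
      by (intro has_derivative_Pair has_derivative_add has_derivative_sum has_derivative_scaleR_left dg) simp_all
    \<comment> \<open>Over \<open>x0\<close> the extensions coincide with g and h on an open slice,
      so the partial derivative of \<open>F\<close> in (y, l) can be computed from the actual
      gradients and Hessians.\<close>
    then have 1: "((\<lambda>v. F (x0, v)) has_derivative F') (at (y0, l0))"
    proof (rule has_derivative_transform_within_open)
      show "open ((\<lambda>v. (x0, v)) -` V)" by (intro open_vimage \<open>open V\<close> continuous_intros)
    qed (use V0 F[OF x0] in auto)
    have "((\<lambda>v. (x0, v)) has_derivative (\<lambda>v. (0, v))) (at (y0, l0))"
      by (intro has_derivative_Pair has_derivative_const has_derivative_ident)
    from has_derivative_compose[OF this smooth_on_open_has_derivative[OF smF V0]]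
    have 2: "((\<lambda>v. F (x0, v)) has_derivative (\<lambda>v. frechet_derivative F (at (x0, y0, l0)) (0, v))) (at (y0, l0))" .
    have "F' w = 0" using fun_cong[OF has_derivative_unique[OF 1 2], of w] that by simp
    then have eq1: "hess_lagr g h x0 y0 l0 d + (\<Sum>i\<in>UNIV. e $ i *\<^sub>R grad (h i x0) y0) = 0"
      and eq2: "l0 $ i * (d \<bullet> grad (h i x0) y0) + e $ i * h i x0 y0 = 0" for i
      by (auto simp: F'_def w zero_prod_def hess_lagr_def sum.distrib add.assoc sum_axis)
    have act: "grad (h i x0) y0 \<bullet> d = 0" if "i \<in> active h x0 y0" for i
      using eq2[of i] KKT_active_pos[OF x0 kkt that] that by (auto simp: active_def inner_commute)
    have inact: "e $ i = 0" if "i \<notin> active h x0 y0" for i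
      using eq2[of i] K(5)[OF that] that by (auto simp: active_def)
    \<comment> \<open>Pairing the first equation with \<open>d\<close> removes the multiplier part:
      active gradients are orthogonal to \<open>d\<close>, and \<open>e\<close> vanishes at inactive
      indices. The second-order inequality then gives d = 0, after which LICQ gives e = 0.\<close>
    have zero: "e $ i * (d \<bullet> grad (h i x0) y0) = 0" for i
      using act[of i] inact[of i] by (cases "i \<in> active h x0 y0") (auto simp: inner_commute)
    have "0 = d \<bullet> (hess_lagr g h x0 y0 l0 d + (\<Sum>i\<in>UNIV. e $ i *\<^sub>R grad (h i x0) y0))"
      by (simp add: eq1)
    also have "\<dots> = d \<bullet> hess_lagr g h x0 y0 l0 d"
      by (simp only: inner_add_right inner_sum_right inner_scaleR_right zero) simp
    also have "\<sigma> * (norm d)\<^sup>2 \<le> \<dots>" using so act unfolding second_order_def by blast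
    finally have "\<sigma> * (norm d)\<^sup>2 \<le> 0" .
    then have "d = 0" using \<open>\<sigma> > 0\<close> by (simp add: mult_le_0_iff)
    then have sum0: "(\<Sum>i\<in>UNIV. e $ i *\<^sub>R grad (h i x0) y0) = 0"
      using eq1 by (simp add: hess_lagr_def)
    obtain c where c: "c > 0" "\<And>\<mu>::real^'k. (\<And>i. i \<notin> active h x0 y0 \<Longrightarrow> \<mu> $ i = 0) \<Longrightarrow>
        c * norm \<mu> \<le> norm (\<Sum>i\<in>UNIV. \<mu> $ i *\<^sub>R grad (h i x0) y0)"
      by (rule independent_family_bounded_below[OF active_independent[OF x0 K(2)]]) blast
    have "c * norm e \<le> 0" using c(2)[of e] inact sum0 by simp
    then have "e = 0" using c(1) by (simp add: mult_le_0_iff)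
    then show "w = 0" using \<open>d = 0\<close> by (simp add: w zero_prod_def)
  qed
  obtain S T s where *: "x0 \<in> S" "open T" "(y0, l0) \<in> T" "smooth_on_open s S" "s x0 = (y0, l0)"
    "\<And>x. x \<in> S \<Longrightarrow> s x \<in> T" "S \<times> T \<subseteq> V" "\<And>x. x \<in> S \<Longrightarrow> F (x, s x) = 0"
    "\<And>x w. x \<in> S \<Longrightarrow> w \<in> T \<Longrightarrow> F (x, w) = 0 \<Longrightarrow> w = s x"
    by (rule smooth_implicit_function[OF smF V0 F0]) (rule inj, assumption, (rule that; assumption))
  show thesis
  proof (rule that[OF *(1-5)])
    show "(y, l) = s x" if "x \<in> S" "x \<in> X" "(y, l) \<in> T" "KKT_pair g h x y l" for x y l
    proof (rule *(9)[OF that(1,3)])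
      have "(x, y, l) \<in> V" using that(1,3) *(7) by blast
      then show "F (x, y, l) = 0"
        using F[OF that(2)] KKT_pairD(1)[OF that(4)] by (simp add: KKT_pairD(4)[OF that(4)] zero_prod_def)
    qed
    show "grad (g x) y + (\<Sum>i\<in>UNIV. l $ i *\<^sub>R grad (h i x) y) = 0 \<and> (\<forall>i. l $ i * h i x y = 0)"
      if "x \<in> S" "x \<in> X" "s x = (y, l)" for x y l
    proof -
      have "(x, y, l) \<in> V" using that *(6)[OF that(1)] *(7) by auto
      then show ?thesis
        using F[OF that(2)] *(8)[OF that(1)] that(3) by (simp add: zero_prod_def sum_axis)
    qed
  qed
qed

section \<open>Local minimizers near a given one\<close>

text \<open>The implicit solution is unique only for pairs in the neighbourhood \<open>T\<close> of
  (y0, l0), whereas \<open>W\<close> restricts y alone. Convergence of the multipliers to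
  \<open>l0\<close>, by \<open>KKT_limit\<close> and \<open>KKT_unique\<close>, closes this gap and
  provides the radius \<open>e1\<close>; within \<open>e2\<close> the branch consists of
  minimizers.\<close>

lemma local_branch:
  assumes x0: "x0 \<in> X" and lm: "local_minimizer g h x0 y0"
  obtains S W s where "x0 \<in> S" "open W" "y0 \<in> W" "smooth_on_open s S"
    "\<And>x. x \<in> S \<Longrightarrow> s x \<in> W"
    "\<And>x y. x \<in> S \<Longrightarrow> x \<in> X \<Longrightarrow> y \<in> W \<Longrightarrow> local_minimizer g h x y \<longleftrightarrow> y = s x"
proof -
  obtain l0 where kkt: "KKT_pair g h x0 y0 l0" by (rule local_minimizer_KKT[OF x0 lm])
  note K = KKT_pairD[OF kkt]
  obtain \<sigma> where \<sigma>: "\<sigma> > 0" "\<And>x y l. x \<in> X \<Longrightarrow> local_minimizer g h x y \<Longrightarrow> KKT_pair g h x y l \<Longrightarrow>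
     second_order g h \<sigma> x y l" by (rule uniform_second_order) blast
  obtain S T s where s: "x0 \<in> S" "open T" "(y0, l0) \<in> T" "smooth_on_open s S" "s x0 = (y0, l0)"
    and uniq: "\<And>x y l. x \<in> S \<Longrightarrow> x \<in> X \<Longrightarrow> (y, l) \<in> T \<Longrightarrow> KKT_pair g h x y l \<Longrightarrow> (y, l) = s x"
    and eqs: "\<And>x y l. x \<in> S \<Longrightarrow> x \<in> X \<Longrightarrow> s x = (y, l) \<Longrightarrow>
       grad (g x) y + (\<Sum>i\<in>UNIV. l $ i *\<^sub>R grad (h i x) y) = 0 \<and> (\<forall>i. l $ i * h i x y = 0)"
    by (rule KKT_smooth_branch[OF x0 kkt \<sigma>(2)[OF x0 lm kkt] \<sigma>(1)]) (rule that; assumption)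
  have "open S" using s(4) by (simp add: smooth_on_open_def)
  have "continuous_on S s" by (rule smooth_on_open_continuous_on[OF s(4)])
  then have s_lim: "(\<lambda>n. s (xs n)) \<longlonglongrightarrow> (y0, l0)" if "xs \<longlonglongrightarrow> x0" for xs
    using \<open>open S\<close> s(1,5) that by (metis continuous_on_eq_continuous_at isCont_tendsto_compose)
  have in_S: "eventually (\<lambda>n. xs n \<in> S) sequentially" if "xs \<longlonglongrightarrow> x0" for xs
    using topological_tendstoD[OF that \<open>open S\<close> s(1)] .

  have "\<exists>e>0. \<forall>x\<in>X. \<forall>y. dist x x0 < e \<longrightarrow> dist y y0 < e \<longrightarrow> local_minimizer g h x y \<longrightarrow> y = fst (s x)"
  proof (rule ccontr)
    assume "\<not> ?thesis"
    then have "\<exists>x y. x \<in> X \<and> dist x x0 < 1 / real (Suc n) \<and> dist y y0 < 1 / real (Suc n) \<and>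
        local_minimizer g h x y \<and> y \<noteq> fst (s x)" for n
      by (meson of_nat_0_less_iff zero_less_Suc zero_less_divide_1_iff)
    then obtain xs ys where xs: "\<And>n. xs n \<in> X" "\<And>n. dist (xs n) x0 < 1 / real (Suc n)"
      and ys: "\<And>n. dist (ys n) y0 < 1 / real (Suc n)"
      and xys: "\<And>n. local_minimizer g h (xs n) (ys n)" "\<And>n. ys n \<noteq> fst (s (xs n))" by metis
    have lims: "xs \<longlonglongrightarrow> x0" "ys \<longlonglongrightarrow> y0" using LIMSEQ_inverse_Suc xs(2) ys by blast+
    have "\<exists>l. KKT_pair g h (xs n) (ys n) l" for n using local_minimizer_KKT[OF xs(1) xys(1)] by blast
    then obtain ls where ls: "\<And>n. KKT_pair g h (xs n) (ys n) (ls n)" by metis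
    obtain r l where r: "strict_mono r" "(\<lambda>n. ls (r n)) \<longlonglongrightarrow> l" "KKT_pair g h x0 y0 l"
      by (rule KKT_limit[OF xs(1) lims(1) x0 lims(2) ls])
    have "l = l0" by (rule KKT_unique[OF x0 r(3) kkt])
    have sub: "(\<lambda>n. xs (r n)) \<longlonglongrightarrow> x0" "(\<lambda>n. ys (r n)) \<longlonglongrightarrow> y0"
      using LIMSEQ_subseq_LIMSEQ[OF lims(1) r(1)] LIMSEQ_subseq_LIMSEQ[OF lims(2) r(1)] by (auto simp: o_def)
    have "(\<lambda>n. (ys (r n), ls (r n))) \<longlonglongrightarrow> (y0, l0)"
      using r(2) sub(2) \<open>l = l0\<close> by (intro tendsto_Pair) auto
    from topological_tendstoD[OF this s(2,3)] in_S[OF sub(1)]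
    have "eventually (\<lambda>n. False) sequentially"
    proof eventually_elim
      case (elim n)
      from uniq[OF elim(2) xs(1) elim(1) ls] xys(2)[of "r n"] show ?case by (metis fst_conv)
    qed
    then show False by simp
  qed
  then obtain e1 where "e1 > 0" and e1: "\<And>x y. x \<in> X \<Longrightarrow> dist x x0 < e1 \<Longrightarrow> dist y y0 < e1 \<Longrightarrow>
      local_minimizer g h x y \<Longrightarrow> y = fst (s x)" by blast

  \<comment> \<open>The implicit equations alone give neither feasibility nor signs. SCSC leaves a
    strict margin at the base point, in l for active and in h for inactive constraints; it persists
    nearby, and the vanishing products settle the other factor.\<close>
  have kkt_near: "eventually (\<lambda>n. KKT_pair g h (xs n) (fst (s (xs n))) (snd (s (xs n)))) sequentially"
    if xs: "\<And>n. xs n \<in> X" "xs \<longlonglongrightarrow> x0" for xs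
  proof -
    have ylim: "(\<lambda>n. fst (s (xs n))) \<longlonglongrightarrow> y0" and llim: "(\<lambda>n. snd (s (xs n))) \<longlonglongrightarrow> l0"
      using tendsto_fst[OF s_lim[OF xs(2)]] tendsto_snd[OF s_lim[OF xs(2)]] by auto
    have "eventually (\<lambda>n. (i \<in> active h x0 y0 \<longrightarrow> snd (s (xs n)) $ i > 0) \<and>
        (i \<notin> active h x0 y0 \<longrightarrow> h i (xs n) (fst (s (xs n))) < 0)) sequentially" for i
    proof (cases "i \<in> active h x0 y0")
      case True
      from order_tendstoD(1)[OF tendsto_vec_nth[OF llim] KKT_active_pos[OF x0 kkt this]] True
      show ?thesis by simp
    next
      case False
      then have "h i x0 y0 < 0" using K(2) by (auto simp: active_def feasible_def less_le)
      from order_tendstoD(2)[OF tendsto_problem(2)[OF xs x0 ylim] this] False show ?thesis by simp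
    qed
    then have "eventually (\<lambda>n. \<forall>i\<in>UNIV. (i \<in> active h x0 y0 \<longrightarrow> snd (s (xs n)) $ i > 0) \<and>
        (i \<notin> active h x0 y0 \<longrightarrow> h i (xs n) (fst (s (xs n))) < 0)) sequentially"
      by (intro eventually_ball_finite) auto
    then show ?thesis using in_S[OF xs(2)]
    proof eventually_elim
      case (elim n)
      have "grad (g (xs n)) (fst (s (xs n))) + (\<Sum>i\<in>UNIV. snd (s (xs n)) $ i *\<^sub>R grad (h i (xs n)) (fst (s (xs n)))) = 0"
        and prod: "\<And>i. snd (s (xs n)) $ i * h i (xs n) (fst (s (xs n))) = 0"
        using eqs[OF elim(2) xs(1), of "fst (s (xs n))" "snd (s (xs n))"] by auto
      moreover have "h i (xs n) (fst (s (xs n))) \<le> 0 \<and> snd (s (xs n)) $ i \<ge> 0" for i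
        using elim(1) prod[of i] by (cases "i \<in> active h x0 y0") (force simp: less_imp_le)+
      ultimately show ?case by (simp add: KKT_pair_def)
    qed
  qed

  have "\<exists>e>0. \<forall>x\<in>X. dist x x0 < e \<longrightarrow> local_minimizer g h x (fst (s x))"
  proof (rule ccontr)
    assume "\<not> ?thesis"
    then have "\<exists>x. x \<in> X \<and> dist x x0 < 1 / real (Suc n) \<and> \<not> local_minimizer g h x (fst (s x))" for n
      by (meson of_nat_0_less_iff zero_less_Suc zero_less_divide_1_iff)
    then obtain xs where xs: "\<And>n. xs n \<in> X" "\<And>n. dist (xs n) x0 < 1 / real (Suc n)"
      "\<And>n. \<not> local_minimizer g h (xs n) (fst (s (xs n)))" by metis
    have xlim: "xs \<longlonglongrightarrow> x0" using LIMSEQ_inverse_Suc xs(2) by blast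
    have ylim: "(\<lambda>n. fst (s (xs n))) \<longlonglongrightarrow> y0" using tendsto_fst[OF s_lim[OF xlim]] by simp
    obtain e where e: "e > 0" "\<And>z. z \<in> feasible h x0 \<Longrightarrow> dist z y0 < e \<Longrightarrow> g x0 y0 \<le> g x0 z"
      using lm by (auto simp: local_minimizer_def)
    \<comment> \<open>\<open>\<rho> < e1\<close> places minimizers in this ball on the branch;
      \<open>2 * \<rho> \<le> e\<close> ensures that the \<rho>-ball around any of its points stays
      where \<open>y0\<close> is optimal.\<close>
    define \<rho> where "\<rho> = min e e1 / 2"
    have \<rho>: "\<rho> > 0" "\<rho> < e1" "2 * \<rho> \<le> e" using e(1) \<open>e1 > 0\<close> by (auto simp: \<rho>_def)
    define A where "A n = feasible h (xs n) \<inter> cball y0 \<rho>" for n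
    have contg: "continuous_on UNIV (g (xs n))" for n
      using has_derivative_continuous[OF smooth_map_on_GDERIV[OF smooth_g xs(1), unfolded gderiv_def]]
      by (simp add: continuous_at_imp_continuous_on)
    have conth: "continuous_on UNIV (h i (xs n))" for n i
      using has_derivative_continuous[OF smooth_map_on_GDERIV[OF smooth_h xs(1), unfolded gderiv_def]]
      by (simp add: continuous_at_imp_continuous_on)
    have "feasible h (xs n) = (\<Inter>i. {z. h i (xs n) z \<le> 0})" for n by (auto simp: feasible_def)
    then have "closed (feasible h (xs n))" for n
      using conth by (auto intro!: closed_INT closed_Collect_le continuous_on_const)
    then have compA: "compact (A n)" for n unfolding A_def by (intro closed_Int_compact) auto
    have "\<exists>z. A n \<noteq> {} \<longrightarrow> z \<in> A n \<and> (\<forall>w\<in>A n. g (xs n) z \<le> g (xs n) w)" for n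
      using continuous_attains_inf[OF compA _ continuous_on_subset[OF contg]] by blast
    then obtain zs where zs: "\<And>n. A n \<noteq> {} \<Longrightarrow> zs n \<in> A n"
      "\<And>n w. A n \<noteq> {} \<Longrightarrow> w \<in> A n \<Longrightarrow> g (xs n) (zs n) \<le> g (xs n) w" by metis
    have "eventually (\<lambda>n. fst (s (xs n)) \<in> A n) sequentially"
      using kkt_near[OF xs(1) xlim] tendstoD[OF ylim \<rho>(1)]
      by eventually_elim (use KKT_pairD(2) in \<open>auto simp: A_def dist_commute less_imp_le\<close>)
    then obtain N where N: "\<And>n. n \<ge> N \<Longrightarrow> fst (s (xs n)) \<in> A n"
      unfolding eventually_sequentially by blast
    \<comment> \<open>From index \<open>N\<close> on, \<open>A n\<close> contains the branch point
      and is nonempty, so the shifted sequence consists of genuine minimizers.\<close>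
    define xt zt where "xt n = xs (n + N)" and "zt n = zs (n + N)" for n
    have zA: "zt n \<in> A (n + N)" "\<And>w. w \<in> A (n + N) \<Longrightarrow> g (xt n) (zt n) \<le> g (xt n) w" for n
      using zs[of "n + N"] N[of "n + N"] unfolding xt_def zt_def by force+
    have "zt n \<in> cball y0 \<rho>" for n using zA(1)[of n] by (simp add: A_def)
    from compact_cball[unfolded compact_def, rule_format, of zt, OF this]
    obtain z r where z: "z \<in> cball y0 \<rho>" and r: "strict_mono r" and zlim: "(zt \<circ> r) \<longlonglongrightarrow> z" by blast
    have xt: "\<And>n. xt (r n) \<in> X" using xs(1) by (simp add: xt_def)
    have "xt \<longlonglongrightarrow> x0" unfolding xt_def[abs_def] by (rule LIMSEQ_ignore_initial_segment[OF xlim])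
    then have xtlim: "(\<lambda>n. xt (r n)) \<longlonglongrightarrow> x0" using LIMSEQ_subseq_LIMSEQ[OF _ r] by (simp add: o_def)
    have ztlim: "(\<lambda>n. zt (r n)) \<longlonglongrightarrow> z" using zlim by (simp add: o_def)
    have feas: "zt n \<in> feasible h (xt n)" for n using zA(1)[of n] by (simp add: A_def xt_def)
    have zfeas: "z \<in> feasible h x0"
      by (rule feasible_limit[OF xt xtlim x0 ztlim feas])
    \<comment> \<open>The branch points compete in the minimization over \<open>A n\<close> and tend
      to \<open>y0\<close>. Being as good as \<open>y0\<close>, the limit \<open>z\<close> is itself
      a local minimizer at \<open>x0\<close>, and \<open>e1\<close> identifies it with
      \<open>y0\<close>.\<close>
    have "g x0 z \<le> g x0 y0"
    proof (rule tendsto_le[OF trivial_limit_sequentially])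
      show "(\<lambda>n. g (xt (r n)) (zt (r n))) \<longlonglongrightarrow> g x0 z"
        by (rule tendsto_problem(1)[OF xt xtlim x0 ztlim])
      have "(\<lambda>n. fst (s (xt (r n)))) \<longlonglongrightarrow> y0" using tendsto_fst[OF s_lim[OF xtlim]] by simp
      then show "(\<lambda>n. g (xt (r n)) (fst (s (xt (r n))))) \<longlonglongrightarrow> g x0 y0"
        by (rule tendsto_problem(1)[OF xt xtlim x0])
      show "eventually (\<lambda>n. g (xt (r n)) (zt (r n)) \<le> g (xt (r n)) (fst (s (xt (r n))))) sequentially"
        using zA(2) N by (simp add: xt_def)
    qed
    moreover have "g x0 y0 \<le> g x0 w" if "w \<in> feasible h x0" "dist w z < \<rho>" for w
    proof (rule e(2)[OF that(1)])
      have "dist w y0 \<le> dist w z + dist y0 z" by (rule dist_triangle2)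
      then show "dist w y0 < e" using that(2) z \<rho>(3) by (simp add: dist_commute)
    qed
    ultimately have "local_minimizer g h x0 z"
      unfolding local_minimizer_def using zfeas \<rho>(1) by (meson order_trans)
    then have "z = fst (s x0)"
      using e1[OF x0, of z] z \<rho>(2) \<open>e1 > 0\<close> by (auto simp: dist_commute)
    then have "z = y0" using s(5) by simp
    have "eventually (\<lambda>n. dist (xt (r n)) x0 < e1) sequentially" by (rule tendstoD[OF xtlim \<open>e1 > 0\<close>])
    moreover have "eventually (\<lambda>n. dist (zt (r n)) y0 < \<rho>) sequentially"
      using tendstoD[OF ztlim \<rho>(1)] \<open>z = y0\<close> by simp
    \<comment> \<open>Near the centre the ball no longer constrains \<open>zt\<close>, which is then
      a local minimizer over all feasible points. By \<open>e1\<close> it lies on the branch,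
      against the choice of \<open>xs\<close>.\<close>
    ultimately have "eventually (\<lambda>n. False) sequentially"
    proof eventually_elim
      case (elim n)
      have "local_minimizer g h (xt (r n)) (zt (r n))"
        unfolding local_minimizer_def
      proof (intro conjI feas exI[of _ "\<rho> - dist (zt (r n)) y0"] ballI impI)
        show "0 < \<rho> - dist (zt (r n)) y0" using elim by simp
        fix w assume w: "w \<in> feasible h (xt (r n))" "dist w (zt (r n)) < \<rho> - dist (zt (r n)) y0"
        then have "dist w y0 < \<rho>" using dist_triangle[of w y0 "zt (r n)"] by linarith
        then show "g (xt (r n)) (zt (r n)) \<le> g (xt (r n)) w"
          using w(1) by (intro zA(2)) (simp add: A_def xt_def dist_commute)
      qed
      moreover from this have "zt (r n) = fst (s (xt (r n)))"
        using elim \<rho>(2) xt by (intro e1) auto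
      ultimately show ?case using xs(3) by (simp add: xt_def)
    qed
    then show False by simp
  qed
  then obtain e2 where "e2 > 0" and e2: "\<And>x. x \<in> X \<Longrightarrow> dist x x0 < e2 \<Longrightarrow> local_minimizer g h x (fst (s x))"
    by blast
  define W where "W = ball y0 e1"
  define S' where "S' = S \<inter> (\<lambda>x. fst (s x)) -` W \<inter> ball x0 (min e1 e2)"
  have smooth: "smooth_on_open (\<lambda>x. fst (s x)) S"
    using s(4) Ck_on_fst[OF \<open>open S\<close>] unfolding smooth_on_open_def by blast
  have "open S'"
    unfolding S'_def W_def
    by (intro open_Int open_ball continuous_open_preimage smooth_on_open_continuous_on[OF smooth] \<open>open S\<close>)
  show thesis
  proof (rule that)
    show "x0 \<in> S'" using s(1,5) \<open>e1 > 0\<close> \<open>e2 > 0\<close> by (simp add: S'_def W_def)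
    show "open W" "y0 \<in> W" using \<open>e1 > 0\<close> by (auto simp: W_def)
    show "smooth_on_open (\<lambda>x. fst (s x)) S'"
      by (rule smooth_on_open_subset[OF smooth \<open>open S'\<close>]) (auto simp: S'_def)
    show "fst (s x) \<in> W" if "x \<in> S'" for x using that by (simp add: S'_def)
    show "local_minimizer g h x y \<longleftrightarrow> y = fst (s x)" if "x \<in> S'" "x \<in> X" "y \<in> W" for x y
      using that e1[of x y] e2[of x] by (auto simp: S'_def W_def dist_commute)
  qed
qed

end

section \<open>The graph of local minimizers as a covering space\<close>

lemma finite_separated:
  fixes F :: "'a::metric_space set"
  assumes "finite F"
  obtains r where "r > 0" "\<And>a b. a \<in> F \<Longrightarrow> b \<in> F \<Longrightarrow> a \<noteq> b \<Longrightarrow> r \<le> dist a b"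
proof -
  \<comment> \<open>The element 1 keeps \<open>D\<close> nonempty when \<open>F\<close> has fewer
    than two points.\<close>
  define D where "D = insert 1 ((\<lambda>(a, b). dist a b) ` {(a, b) \<in> F \<times> F. a \<noteq> b})"
  have "finite {(a, b) \<in> F \<times> F. a \<noteq> b}" by (rule finite_subset[of _ "F \<times> F"]) (use assms in auto)
  then have "finite D" by (simp add: D_def)
  then have "Min D \<in> D" by (rule Min_in) (simp add: D_def)
  then have "Min D > 0" by (auto simp: D_def)
  moreover have "Min D \<le> dist a b" if "a \<in> F" "b \<in> F" "a \<noteq> b" for a b
    using \<open>finite D\<close> that by (intro Min_le) (auto simp: D_def)
  ultimately show thesis using that by blast
qed

text \<open>Local graphs alone make the projection a local homeomorphism. Boundedness and closedness
  make the fibres compact, hence finite as they are discrete, and keep all points of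
  \<open>E\<close> over a small neighbourhood on the sheets through the fibre. Closedness is asked
  relative to \<open>X\<close>.\<close>

lemma covering_space_local_graph:
  fixes E :: "('a::euclidean_space \<times> 'b::euclidean_space) set"
  assumes onto: "fst ` E = X" and bd: "\<And>p. p \<in> E \<Longrightarrow> norm (snd p) \<le> R"
    and closed: "\<And>x y xs ys. (\<And>n. (xs n, ys n) \<in> E) \<Longrightarrow> xs \<longlonglongrightarrow> x \<Longrightarrow> x \<in> X \<Longrightarrow> ys \<longlonglongrightarrow> y \<Longrightarrow> (x, y) \<in> E"
    and graph: "\<And>x y. (x, y) \<in> E \<Longrightarrow> \<exists>T W s. openin (top_of_set X) T \<and> x \<in> T \<and> open W \<and> y \<in> W \<and>
      continuous_on T s \<and> (\<forall>a\<in>T. s a \<in> W) \<and> (\<forall>a\<in>T. \<forall>b\<in>W. (a, b) \<in> E \<longleftrightarrow> b = s a)"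
  shows "covering_space E fst X"
  unfolding covering_space_def
proof (intro conjI ballI onto continuous_on_fst continuous_on_id)
  fix x assume x: "x \<in> X"
  define F where "F = {y. (x, y) \<in> E}"
  define Q where "Q y T W s \<longleftrightarrow> openin (top_of_set X) T \<and> x \<in> T \<and> open W \<and> y \<in> W \<and>
      continuous_on T s \<and> (\<forall>a\<in>T. s a \<in> W) \<and> (\<forall>a\<in>T. \<forall>b\<in>W. (a, b) \<in> E \<longleftrightarrow> b = s a)" for y T W s
  have "\<exists>T W s. Q y T W s" if "y \<in> F" for y
    using graph that by (simp add: F_def Q_def)
  then obtain T W s where Q: "\<And>y. y \<in> F \<Longrightarrow> Q y (T y) (W y) (s y)"
    by metis
  have T: "openin (top_of_set X) (T y)" "x \<in> T y" and W: "open (W y)" "y \<in> W y"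
    and s: "continuous_on (T y) (s y)" "\<And>a. a \<in> T y \<Longrightarrow> s y a \<in> W y"
      "\<And>a b. a \<in> T y \<Longrightarrow> b \<in> W y \<Longrightarrow> (a, b) \<in> E \<longleftrightarrow> b = s y a" if "y \<in> F" for y
    using Q[OF that] unfolding Q_def by blast+
  have "bounded F" using bd by (intro boundedI[of _ R]) (force simp: F_def)
  moreover have "closed F"
    unfolding closed_sequential_limits
  proof (intro allI impI)
    fix ys y assume "(\<forall>n. ys n \<in> F) \<and> ys \<longlonglongrightarrow> y"
    then show "y \<in> F" using closed[of "\<lambda>_. x" ys x y] x by (simp add: F_def)
  qed
  ultimately have "compact F" by (simp add: compact_eq_bounded_closed)
  moreover have "F \<subseteq> (\<Union>y\<in>F. W y)" using W(2) by blast
  ultimately obtain D where D: "D \<subseteq> F" "finite D" "F \<subseteq> (\<Union>y\<in>D. W y)"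
    using W(1) by (metis compactE_image)
  have sx: "s y x = y" if "y \<in> F" for y using s(3)[OF that T(2)[OF that] W(2)[OF that]] that by (simp add: F_def)
  \<comment> \<open>\<open>W y'\<close> meets the fibre in \<open>y'\<close> alone, so the centres
    of a finite subcover exhaust the fibre.\<close>
  have "y \<in> D" if y: "y \<in> F" for y
  proof -
    obtain y' where y': "y' \<in> D" "y \<in> W y'" using D(3) y by blast
    then have "y' \<in> F" using D(1) by blast
    then have "y = s y' x" using s(3)[of y' x y] T(2)[of y'] y' y by (simp add: F_def)
    then show ?thesis using sx[OF \<open>y' \<in> F\<close>] y'(1) by simp
  qed
  then have "F \<subseteq> D" by auto
  then have "finite F" using D(2) by (rule finite_subset)
  obtain r where r: "r > 0" "\<And>a b. a \<in> F \<Longrightarrow> b \<in> F \<Longrightarrow> a \<noteq> b \<Longrightarrow> r \<le> dist a b"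
    by (rule finite_separated[OF \<open>finite F\<close>]) (rule that; assumption)
  define W' where "W' y = W y \<inter> ball y (r / 2)" for y
  have W': "open (W' y)" "y \<in> W' y" if "y \<in> F" for y using W that r(1) by (auto simp: W'_def)
  have disj: "W' a \<inter> W' b = {}" if "a \<in> F" "b \<in> F" "a \<noteq> b" for a b
  proof (rule ccontr)
    assume "W' a \<inter> W' b \<noteq> {}"
    then obtain c where "dist a c < r / 2" "dist b c < r / 2" by (auto simp: W'_def)
    then show False using r(2)[OF that] dist_triangle2[of a b c] by linarith
  qed
  \<comment> \<open>Properness: points of \<open>E\<close> over a sequence tending to
    \<open>x\<close> accumulate at a point of the fibre, so they cannot avoid the open sets
    \<open>W' y\<close>.\<close>
  have "\<exists>e>0. \<forall>a b. (a, b) \<in> E \<longrightarrow> dist a x < e \<longrightarrow> b \<in> (\<Union>y\<in>F. W' y)"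
  proof (rule ccontr)
    assume "\<not> ?thesis"
    then have "\<exists>a b. (a, b) \<in> E \<and> dist a x < 1 / real (Suc n) \<and> b \<notin> (\<Union>y\<in>F. W' y)" for n
      by (meson of_nat_0_less_iff zero_less_Suc zero_less_divide_1_iff)
    then obtain as bs where ab: "\<And>n. (as n, bs n) \<in> E" "\<And>n. dist (as n) x < 1 / real (Suc n)"
      "\<And>n. bs n \<notin> (\<Union>y\<in>F. W' y)" by metis
    have alim: "as \<longlonglongrightarrow> x" using LIMSEQ_inverse_Suc ab(2) by blast
    have "bounded (range bs)" using bd[OF ab(1)] by (intro boundedI[of _ R]) auto
    then obtain b q where q: "strict_mono q" "(bs \<circ> q) \<longlonglongrightarrow> b"
      using bounded_imp_convergent_subsequence by blast
    have blim: "(\<lambda>n. bs (q n)) \<longlonglongrightarrow> b" using q(2) by (simp add: o_def)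
    have "(\<lambda>n. as (q n)) \<longlonglongrightarrow> x" using LIMSEQ_subseq_LIMSEQ[OF alim q(1)] by (simp add: o_def)
    then have "b \<in> F" using closed[OF ab(1) _ x blim] by (simp add: F_def)
    from topological_tendstoD[OF blim W'[OF this]] have "eventually (\<lambda>n. False) sequentially"
      by (rule eventually_mono) (use ab(3) \<open>b \<in> F\<close> in blast)
    then show False by simp
  qed
  then obtain e where "e > 0" and e: "\<And>a b. (a, b) \<in> E \<Longrightarrow> dist a x < e \<Longrightarrow> b \<in> (\<Union>y\<in>F. W' y)" by blast
  \<comment> \<open>The ball confines all points over \<open>N\<close> to the sets
    \<open>W' y\<close>; the second condition keeps each section \<open>s y\<close> in its own
    \<open>W' y\<close>, so that every sheet extends over all of \<open>N\<close>.\<close>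
  define N where "N = (X \<inter> ball x e) \<inter> (X \<inter> (\<Inter>y\<in>F. {a \<in> T y. s y a \<in> W' y}))"
  have "openin (top_of_set X) {a \<in> T y. s y a \<in> W' y}" if "y \<in> F" for y
  proof -
    have "openin (top_of_set (T y)) (T y \<inter> s y -` W' y)"
      using continuous_openin_preimage_gen[OF s(1)[OF that] W'(1)[OF that]] .
    then have "openin (top_of_set X) (T y \<inter> s y -` W' y)" using T(1)[OF that] by (rule openin_trans)
    moreover have "T y \<inter> s y -` W' y = {a \<in> T y. s y a \<in> W' y}" by blast
    ultimately show ?thesis by simp
  qed
  then have "openin (top_of_set X) (X \<inter> (\<Inter>y\<in>F. {a \<in> T y. s y a \<in> W' y}))"
    using openin_INT[OF \<open>finite F\<close>, of "top_of_set X" "\<lambda>y. {a \<in> T y. s y a \<in> W' y}"]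
    by (simp add: Int_commute)
  then have N: "openin (top_of_set X) N"
    unfolding N_def by (rule openin_Int[OF openin_open_Int[OF open_ball]])
  have Ns: "a \<in> T y" "s y a \<in> W' y" if "a \<in> N" "y \<in> F" for a y using that by (auto simp: N_def)
  define u where "u y = {p \<in> E. fst p \<in> N \<and> snd p \<in> W' y}" for y
  have u_eq: "p \<in> u y \<longleftrightarrow> fst p \<in> N \<and> snd p = s y (fst p)" if y: "y \<in> F" for p y
  proof (cases p)
    case (Pair a b)
    show ?thesis
    proof (cases "a \<in> N")
      case True
      then show ?thesis
        using s(3)[OF y Ns(1)[OF True y], of b] s(2)[OF y Ns(1)[OF True y]] s(3)[OF y Ns(1)[OF True y], of "s y a"]
          Ns(2)[OF True y]
        by (auto simp: Pair u_def W'_def)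
    qed (simp add: Pair u_def)
  qed
  show "\<exists>T. x \<in> T \<and> openin (top_of_set X) T \<and>
     (\<exists>v. \<Union>v = E \<inter> fst -` T \<and> (\<forall>u\<in>v. openin (top_of_set E) u) \<and> pairwise disjnt v \<and>
       (\<forall>u\<in>v. \<exists>q. homeomorphism u T fst q))"
  proof (intro exI[of _ N] conjI exI[of _ "u ` F"])
    show "x \<in> N" using x \<open>e > 0\<close> T(2) W'(2) sx by (auto simp: N_def)
    show "openin (top_of_set X) N" by (rule N)
    show "\<Union> (u ` F) = E \<inter> fst -` N"
    proof (intro equalityI subsetI)
      fix p assume p: "p \<in> E \<inter> fst -` N"
      then have "dist (fst p) x < e" by (auto simp: N_def dist_commute)
      then obtain y where "y \<in> F" "snd p \<in> W' y" using e[of "fst p" "snd p"] p by auto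
      then show "p \<in> \<Union> (u ` F)" using p by (auto simp: u_def)
    qed (auto simp: u_def)
    show "\<forall>w\<in>u ` F. openin (top_of_set E) w"
    proof safe
      fix y assume y: "y \<in> F"
      have 1: "openin (top_of_set E) (E \<inter> fst -` N)"
        by (rule continuous_openin_preimage[OF _ _ N]) (use onto in \<open>auto intro: continuous_intros\<close>)
      have 2: "openin (top_of_set E) (E \<inter> snd -` W' y)"
        by (rule continuous_openin_preimage_gen[OF _ W'(1)[OF y]]) (auto intro: continuous_intros)
      have "u y = (E \<inter> fst -` N) \<inter> (E \<inter> snd -` W' y)" by (auto simp: u_def)
      then show "openin (top_of_set E) (u y)" using openin_Int[OF 1 2] by simp
    qed
    show "pairwise disjnt (u ` F)"
      unfolding pairwise_def disjnt_def using disj by (fastforce simp: u_def)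
    show "\<forall>w\<in>u ` F. \<exists>q. homeomorphism w N fst q"
    proof safe
      fix y assume y: "y \<in> F"
      have "continuous_on N (s y)" by (rule continuous_on_subset[OF s(1)[OF y]]) (use Ns(1) y in blast)
      then have "homeomorphism (u y) N fst (\<lambda>a. (a, s y a))"
        using u_eq[OF y]
        by (intro homeomorphismI) (auto intro!: continuous_intros prod_eqI)
      then show "\<exists>q. homeomorphism (u y) N fst q" by blast
    qed
  qed
qed

section \<open>Local path connectedness of manifolds with generalized boundary\<close>

lemma locally_open_cover:
  assumes "\<And>p. p \<in> X \<Longrightarrow> \<exists>U. open U \<and> p \<in> U \<and> locally P (U \<inter> X)"
  shows "locally P X"
proof (rule locallyI)
  fix w p assume w: "openin (top_of_set X) w" "p \<in> w"
  then have "p \<in> X" using openin_imp_subset by blast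
  then obtain U where U: "open U" "p \<in> U" "locally P (U \<inter> X)" using assms by blast
  have "openin (top_of_set (U \<inter> X)) (U \<inter> w)"
    using w(1) by (auto simp: openin_open)
  then obtain A B where AB: "openin (top_of_set (U \<inter> X)) A" "P B" "p \<in> A" "A \<subseteq> B" "B \<subseteq> U \<inter> w"
    using U(2,3) w(2) by (meson IntI locallyE)
  have "openin (top_of_set X) (U \<inter> X)" using openin_open_Int[OF U(1), of X] by (simp add: inf_commute)
  from openin_trans[OF AB(1) this] have "openin (top_of_set X) A" .
  then show "\<exists>A B. openin (top_of_set X) A \<and> P B \<and> p \<in> A \<and> A \<subseteq> B \<and> B \<subseteq> w" using AB by blast
qed

text \<open>A chart carries \<open>X\<close> near \<open>p\<close> to a relatively open part of the
  convex set \<open>C\<close>, and convex sets are locally path connected. The lifting criterion for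
  coverings asks for this beside simple connectedness.\<close>

lemma manifold_gen_boundary_locally_path_connected:
  fixes X :: "(real^'n) set"
  assumes "manifold_gen_boundary X"
  shows "locally path_connected X"
proof (rule locally_open_cover)
  fix p assume "p \<in> X"
  from assms[unfolded manifold_gen_boundary_def, rule_format, OF this]
  obtain U V :: "(real^'n) set" and \<psi> \<phi> and Q P :: "'n set" where
    U: "p \<in> U" "homeomorphism U V \<psi> \<phi>" "smooth_on_open \<psi> U" "smooth_on_open \<phi> V" and
    img: "\<psi> ` (U \<inter> X) = {v\<in>V. (\<forall>i\<in>Q. v $ i = 0) \<and> (\<forall>i\<in>P. v $ i \<ge> 0)}"
    by (elim exE conjE) (rule that; assumption)
  define C where "C = {v :: real^'n. (\<forall>i\<in>Q. v $ i = 0) \<and> (\<forall>i\<in>P. v $ i \<ge> 0)}"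
  have "convex C" by (auto simp: convex_def C_def)
  then have "locally path_connected C" by (rule convex_imp_locally_path_connected)
  moreover have "openin (top_of_set C) (C \<inter> V)"
    using U(4) by (auto simp: smooth_on_open_def openin_open_Int)
  ultimately have lpc: "locally path_connected (C \<inter> V)" by (rule locally_open_subset)
  have "\<psi> ` (U \<inter> X) = C \<inter> V" unfolding img by (auto simp: C_def)
  then have "homeomorphism (U \<inter> X) (C \<inter> V) \<psi> \<phi>"
    by (intro homeomorphism_of_subsets[OF U(2)]) auto
  then have "U \<inter> X homeomorphic C \<inter> V" by (auto simp: homeomorphic_def)
  then have "locally path_connected (U \<inter> X) \<longleftrightarrow> locally path_connected (C \<inter> V)"
    by (rule homeomorphic_locally) (rule homeomorphic_path_connectedness)
  then have "locally path_connected (U \<inter> X)" using lpc by simp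
  then show "\<exists>U. open U \<and> p \<in> U \<and> locally path_connected (U \<inter> X)"
    using U(1,3) by (auto simp: smooth_on_open_def)
qed

section \<open>Global branches as lifts of the identity\<close>

context lower_level_problem
begin

text \<open>Supplies surjectivity of the projection onto \<open>X\<close>, by compactness of the
  feasible set.\<close>

lemma local_minimizer_exists:
  assumes x: "x \<in> X"
  obtains y where "local_minimizer g h x y"
proof -
  have cont: "continuous_on S (g x)" "continuous_on S (h i x)" for i S
    using has_derivative_continuous[OF smooth_map_on_GDERIV[OF smooth_g x, unfolded gderiv_def]]
      has_derivative_continuous[OF smooth_map_on_GDERIV[OF smooth_h x, unfolded gderiv_def]]
    by (simp_all add: continuous_at_imp_continuous_on)
  have "feasible h x = (\<Inter>i. {z. h i x z \<le> 0})" by (auto simp: feasible_def)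
  then have "closed (feasible h x)"
    using cont by (auto intro!: closed_INT closed_Collect_le continuous_on_const)
  moreover obtain R where "feasible h x \<subseteq> cball 0 R"
    using bounded x by (force simp: uniformly_bounded_def)
  then have "bounded (feasible h x)" using bounded_subset[OF bounded_cball] by blast
  ultimately have "compact (feasible h x)" by (simp add: compact_eq_bounded_closed)
  from continuous_attains_inf[OF this nonempty[OF x] cont(1)]
  obtain y where "y \<in> feasible h x" "\<forall>z\<in>feasible h x. g x y \<le> g x z" by blast
  then have "local_minimizer g h x y"
    unfolding local_minimizer_def using zero_less_one by blast
  then show thesis by (rule that)
qed

definition minimizer_graph :: "((real^'n) \<times> (real^'m)) set" where
  "minimizer_graph = {(x, y). x \<in> X \<and> local_minimizer g h x y}"

lemma covering_space_minimizer_graph: "covering_space minimizer_graph fst X"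
proof -
  obtain R where R: "\<forall>x\<in>X. feasible h x \<subseteq> {y. norm y \<le> R}"
    using bounded unfolding uniformly_bounded_def by blast
  show ?thesis
  proof (rule covering_space_local_graph)
    have "x \<in> fst ` minimizer_graph" if x: "x \<in> X" for x
    proof -
      obtain y where "local_minimizer g h x y" by (rule local_minimizer_exists[OF x])
      then have "(x, y) \<in> minimizer_graph" using x by (simp add: minimizer_graph_def)
      then show ?thesis by (rule rev_image_eqI) simp
    qed
    then show "fst ` minimizer_graph = X" by (auto simp: minimizer_graph_def)
    show "norm (snd p) \<le> R" if "p \<in> minimizer_graph" for p
    proof -
      have "fst p \<in> X" "snd p \<in> feasible h (fst p)"
        using that by (auto simp: minimizer_graph_def local_minimizer_def)
      then show ?thesis using R by blast
    qed
    show "(x, y) \<in> minimizer_graph"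
      if "\<And>n. (xs n, ys n) \<in> minimizer_graph" "xs \<longlonglongrightarrow> x" "x \<in> X" "ys \<longlonglongrightarrow> y" for x y xs ys
      using local_minimizer_limit[OF _ that(2-4)] that(1,3) by (simp add: minimizer_graph_def)
    fix x y assume "(x, y) \<in> minimizer_graph"
    then have xy: "x \<in> X" "local_minimizer g h x y" by (auto simp: minimizer_graph_def)
    obtain S W s where S: "x \<in> S" "open W" "y \<in> W" "smooth_on_open s S" "\<And>a. a \<in> S \<Longrightarrow> s a \<in> W"
      "\<And>a b. a \<in> S \<Longrightarrow> a \<in> X \<Longrightarrow> b \<in> W \<Longrightarrow> local_minimizer g h a b \<longleftrightarrow> b = s a"
      by (rule local_branch[OF xy]) (rule that; assumption)
    have "openin (top_of_set X) (X \<inter> S)" using S(4) by (simp add: smooth_on_open_def openin_open_Int)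
    moreover have "continuous_on (X \<inter> S) s"
      using smooth_on_open_continuous_on[OF S(4)] by (rule continuous_on_subset) auto
    ultimately show "\<exists>T W s. openin (top_of_set X) T \<and> x \<in> T \<and> open W \<and> y \<in> W \<and>
        continuous_on T s \<and> (\<forall>a\<in>T. s a \<in> W) \<and> (\<forall>a\<in>T. \<forall>b\<in>W. (a, b) \<in> minimizer_graph \<longleftrightarrow> b = s a)"
      using S xy(1) by (intro exI[of _ "X \<inter> S"] exI[of _ W] exI[of _ s]) (auto simp: minimizer_graph_def)
  qed
qed

text \<open>Continuity keeps \<open>ys x\<close> in the set \<open>W\<close> where local minimizers
  are given by \<open>s\<close>. So \<open>ys\<close> agrees near \<open>p\<close> with
  \<open>s\<close>, which is smooth on an open set of the ambient space even where \<open>X\<close>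
  has boundary.\<close>

lemma continuous_branch_smooth:
  assumes "local_minimizer_branch g h X ys"
  shows "smooth_map_on ys X"
  unfolding smooth_map_on_def
proof
  fix p assume p: "p \<in> X"
  have cont: "continuous_on X ys" and lm: "\<And>x. x \<in> X \<Longrightarrow> local_minimizer g h x (ys x)"
    using assms by (auto simp: local_minimizer_branch_def)
  obtain S W s where S: "p \<in> S" "open W" "ys p \<in> W" "smooth_on_open s S"
    "\<And>a b. a \<in> S \<Longrightarrow> a \<in> X \<Longrightarrow> b \<in> W \<Longrightarrow> local_minimizer g h a b \<longleftrightarrow> b = s a"
    by (rule local_branch[OF p lm[OF p]]) (rule that; assumption)
  obtain A where A: "open A" "A \<inter> X = ys -` W \<inter> X"
    using cont S(2) unfolding continuous_on_open_invariant by blast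
  have "smooth_on_open s (S \<inter> A)"
    by (rule smooth_on_open_subset[OF S(4)]) (use S(4) A(1) in \<open>auto simp: smooth_on_open_def\<close>)
  moreover have "s x = ys x" if "x \<in> (S \<inter> A) \<inter> X" for x
  proof -
    have "x \<in> S" "x \<in> X" "ys x \<in> W" using that A(2) by auto
    then show ?thesis using S(5)[of x "ys x"] lm[of x] by simp
  qed
  moreover have "p \<in> S \<inter> A" using S(1,3) A(2) p by blast
  ultimately show "\<exists>U F. p \<in> U \<and> smooth_on_open F U \<and> (\<forall>x\<in>U \<inter> X. F x = ys x)" by blast
qed

text \<open>\<open>\<lambda>x. (x, ys x)\<close> is a lift of the identity, and a lift over a
  connected base is determined by one value.\<close>

lemma branch_unique:
  assumes "connected X" "x0 \<in> X" "local_minimizer_branch g h X ys" "local_minimizer_branch g h X zs"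
    and "ys x0 = zs x0" "x \<in> X"
  shows "ys x = zs x"
proof -
  have "(x, ys x) = (x, zs x)"
  proof (rule covering_space_lift_unique[OF covering_space_minimizer_graph, of "\<lambda>x. (x, ys x)" x0 "\<lambda>x. (x, zs x)" X "\<lambda>x. x"])
    show "continuous_on X (\<lambda>x. (x, ys x))" "continuous_on X (\<lambda>x. (x, zs x))"
      using assms(3,4) by (auto simp: local_minimizer_branch_def intro!: continuous_on_Pair continuous_on_id)
    show "(\<lambda>x. (x, ys x)) \<in> X \<rightarrow> minimizer_graph" "(\<lambda>x. (x, zs x)) \<in> X \<rightarrow> minimizer_graph"
      using assms(3,4) by (auto simp: local_minimizer_branch_def minimizer_graph_def)
  qed (use assms in auto)
  then show ?thesis by simp
qed

lemma branch_exists: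
  assumes "simply_connected X" "locally path_connected X" "x0 \<in> X" "local_minimizer g h x0 y0"
  obtains ys where "local_minimizer_branch g h X ys" "ys x0 = y0"
proof -
  have "(x0, y0) \<in> minimizer_graph" using assms by (simp add: minimizer_graph_def)
  from covering_space_lift_strong[OF covering_space_minimizer_graph this assms(3,1,2) continuous_on_id]
  obtain f where f: "continuous_on X f" "f \<in> X \<rightarrow> minimizer_graph" "f x0 = (x0, y0)" "\<And>x. x \<in> X \<Longrightarrow> fst (f x) = x"
    by auto
  have "local_minimizer g h x (snd (f x))" if "x \<in> X" for x
    using f(2) f(4)[OF that] that by (cases "f x") (auto simp: minimizer_graph_def Pi_iff)
  then have "local_minimizer_branch g h X (\<lambda>x. snd (f x))"
    using f(1) by (auto simp: local_minimizer_branch_def intro: continuous_on_snd)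
  then show thesis using that f(3) by simp
qed

end

theorem theorem4p1:
  fixes X :: "(real^'n) set"
    and g :: "real^'n \<Rightarrow> real^'m \<Rightarrow> real"
    and h :: "'k::finite \<Rightarrow> real^'n \<Rightarrow> real^'m \<Rightarrow> real"
    and x0 :: "real^'n" and y0 :: "real^'m"
  assumes "manifold_gen_boundary X" and "connected X" and "simply_connected X"
    and "smooth_map_on (\<lambda>(x, y). g x y) (X \<times> UNIV)"
    and "\<And>i. smooth_map_on (\<lambda>(x, y). h i x y) (X \<times> UNIV)"
    and "\<And>x. x \<in> X \<Longrightarrow> feasible h x \<noteq> {}"
    and "uniformly_bounded h X"
    and "\<And>x. x \<in> X \<Longrightarrow> LICQ h x"
    and "\<And>x. x \<in> X \<Longrightarrow> SCSC g h x"
    and "uniform_SOSC g h X"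
    and "x0 \<in> X" and "local_minimizer g h x0 y0"
  shows "\<exists>!ys. ys \<in> extensional X \<and> local_minimizer_branch g h X ys \<and>
           smooth_map_on ys X \<and> ys x0 = y0"
proof -
  interpret lower_level_problem X g h
    using assms(4-10) by unfold_locales
  obtain zs where zs: "local_minimizer_branch g h X zs" "zs x0 = y0"
    using branch_exists[OF assms(3) manifold_gen_boundary_locally_path_connected[OF assms(1)] assms(11,12)] .
  \<comment> \<open>A branch is constrained on \<open>X\<close> only; fixing the value
    \<open>undefined\<close> elsewhere turns agreement on \<open>X\<close> into equality of
    functions.\<close>
  have branch: "local_minimizer_branch g h X (restrict zs X)"
    using zs(1) by (simp add: local_minimizer_branch_def cong: continuous_on_cong)
  show ?thesis
  proof (rule ex1I[of _ "restrict zs X"])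
    show "restrict zs X \<in> extensional X \<and> local_minimizer_branch g h X (restrict zs X) \<and>
        smooth_map_on (restrict zs X) X \<and> restrict zs X x0 = y0"
      using branch continuous_branch_smooth zs(2) assms(11) by simp
    fix ys assume ys: "ys \<in> extensional X \<and> local_minimizer_branch g h X ys \<and> smooth_map_on ys X \<and> ys x0 = y0"
    show "ys = restrict zs X"
    proof (rule extensionalityI)
      show "ys x = restrict zs X x" if "x \<in> X" for x
        by (rule branch_unique[OF assms(2,11) _ branch _ that]) (use ys zs(2) assms(11) in auto)
    qed (use ys in auto)
  qed
qed

end
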